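(* Let $l$ be a positive integer, $j$ an integer such that every denominator appearing below is nonzero, and $q\in\mathbb{C}$ with $0<|q|<1$. Then \begin{align*} &\frac{[q^{2l+j},q^{4l};q^{6l}]_\infty(q^{6l};q^{6l})^2_\infty}{[-q^{j},-q^{2l},-q^{4l+j};q^{6l}]_\infty}\bigg\{j+\sum_{m=0}^\infty\bigg[2\biggl(\frac{ q^{6lm+2l}}{1+q^{6lm+2l}}-\frac{ q^{6lm+4l}}{1+q^{6lm+4l}}-\frac{ q^{6lm+2l+j}}{1-q^{6lm+2l+j}} +\frac{ q^{6lm+4l-j}}{1-q^{6lm+4l-j}}\biggr)\\ &\qquad -4 \left(\frac{ q^{6lm+4l+j}}{1-q^{6lm+4l+j}}-\frac{ q^{6lm+2l-j}}{1-q^{6lm+2l-j}}\right)\bigg]\bigg\}\\ &=-\sum_{n=-\infty}^\infty \frac{(6n+4+j)q^{3ln(n+1)+2ln+2l}}{1+q^{6ln+j+4l}} +\sum_{n=-\infty}^\infty \frac{(6n+j)q^{3ln(n+1)-2ln}}{1+q^{6ln+j}}\\ &\quad +\frac{2(q^{2l};q^{2l})^2_\infty}{(-q^{2l};q^{2l})^2_\infty}\sum_{n=-\infty}^\infty \frac{(-1)^nq^{3ln(n+1)+2ln+2l}}{1-q^{6ln+j+4l}}. \end{align*}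
   Context: For $|p|<1$: $(a;p)_\infty=\prod_{k\ge 0}(1-ap^k)$, $(a_1,\dots,a_m;p)_\infty=(a_1;p)_\infty\cdots(a_m;p)_\infty$, and $[a_1,\dots,a_m;p]_\infty=(a_1,p/a_1,\dots,a_m,p/a_m;p)_\infty$. *)

theory Defs
  imports "HOL-Analysis.Analysis"
begin

(* (a; p)_inf and (a_1, ..., a_m; p)_inf.  The product converges for norm p < 1, and prodinf
   allows vanishing factors: it is then 0. *)

definition qpoch :: "complex \<Rightarrow> complex \<Rightarrow> complex" where
  "qpoch a p = (\<Prod>k. 1 - a * p ^ k)"

definition qpochs :: "complex list \<Rightarrow> complex \<Rightarrow> complex" where
  "qpochs xs p = (\<Prod>a\<leftarrow>xs. qpoch a p)"

(* [a_1, ..., a_m; p]_inf = (a_1, p/a_1, ..., a_m, p/a_m; p)_inf, meant for nonzero a_i *)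

definition qbracket :: "complex list \<Rightarrow> complex \<Rightarrow> complex" where
  "qbracket xs p = qpochs (concat (map (\<lambda>a. [a, p / a]) xs)) p"

end

theory Submission
  imports Defs "HOL-Complex_Analysis.Complex_Analysis"
begin

text \<open>
  Put \<open>Q = q^l\<close>, \<open>w = Q^2\<close>, \<open>p = w^3\<close>, \<open>x = q^j\<close> and \<open>\<theta>(z) = [z; p]\<close>. The identity has the form
  \<open>j * A + B\<close>, where \<open>A\<close> and \<open>B\<close> are identities between meromorphic functions of a free variable
  \<open>x \<noteq> 0\<close>. In each of them the difference \<open>f\<close> of the two sides satisfies
  \<open>f(p x) = - w x f(x) + C\<close> with \<open>C\<close> constant (for \<open>B\<close> after using \<open>A\<close>), and its possible poles on the
  orbits of \<open>-1\<close>, \<open>\<plusminus>1/w^2\<close> and \<open>1/w\<close> under \<open>x \<mapsto> p x\<close> cancel. Hence \<open>f\<close> extends to an entire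
  function that tends to \<open>0\<close> at infinity, so \<open>f = 0\<close> by Liouville, whatever \<open>C\<close> is.
\<close>

section \<open>q-Pochhammer symbols and theta functions\<close>

text \<open>The values \<open>q^j\<close> form a discrete set, so \<open>x\<close> has to be freed
  before analysis applies; \<open>j\<close> then survives only as an explicit coefficient. The
  multiplier \<open>- w x\<close> comes from the theta factors on the product side. In a bilateral
  series the shift n -> n - 1 reproduces it, but leaves behind a sum without denominators, and this
  is the constant C.

  C is harmless because the argument uses growth only: read outwards, the equation is f(x) = (C -
  f(p x)) / (w x), so moving away from the origin gains a factor 1/x at every step.

  B does not obey such an equation by itself. The shift lowers both the logarithmic-derivative
  factor and the linear weights 6 n + const by 6, and the surplus is 6 w x times the difference of
  the two sides of A, which is 0.

  The equation also transports limits along an orbit, so the poles have to be cancelled at one point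
  of each orbit only.\<close>

lemma qpoch_has_prod:
  assumes "norm p < 1"
  shows "(\<lambda>k. 1 - a * p ^ k) has_prod qpoch a p"
proof -
  have "summable (\<lambda>k. norm (a * p ^ k))"
    using assms by (simp add: norm_mult norm_power summable_geometric)
  then have "abs_convergent_prod (\<lambda>k. 1 + (- (a * p ^ k)))"
    by (intro summable_imp_abs_convergent_prod) simp
  then show ?thesis
    unfolding qpoch_def
    by (intro convergent_prod_has_prod abs_convergent_prod_imp_convergent_prod) simp
qed

lemma qpoch_eq_0_iff:
  assumes "norm p < 1"
  shows "qpoch a p = 0 \<longleftrightarrow> (\<exists>k. a * p ^ k = 1)"
  using has_prod_eq_0_iff[OF qpoch_has_prod[OF assms, of a]] by (auto simp: image_iff)

lemma qpoch_LIMSEQ: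
  assumes "norm p < 1"
  shows "(\<lambda>n. \<Prod>k<n. 1 - a * p ^ k) \<longlonglongrightarrow> qpoch a p"
  using has_prod_imp_tendsto'[OF qpoch_has_prod[OF assms]] .

lemma qpoch_rec:
  assumes "norm p < 1"
  shows "qpoch a p = (1 - a) * qpoch (a * p) p"
proof -
  have "(\<lambda>n. (1 - a) * (\<Prod>k<n. 1 - a * p * p ^ k)) \<longlonglongrightarrow> (1 - a) * qpoch (a * p) p"
    by (intro tendsto_intros qpoch_LIMSEQ assms)
  moreover have "(1 - a) * (\<Prod>k<n. 1 - a * p * p ^ k) = (\<Prod>k<Suc n. 1 - a * p ^ k)" for n
    unfolding prod.lessThan_Suc_shift by (simp add: mult.assoc)
  moreover have "(\<lambda>n. \<Prod>k<Suc n. 1 - a * p ^ k) \<longlonglongrightarrow> qpoch a p"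
    using LIMSEQ_Suc[OF qpoch_LIMSEQ[OF assms]] .
  ultimately show ?thesis
    using LIMSEQ_unique by force
qed

text \<open>Splits the exponents by their residue modulo 3. This links the base \<open>Q ^ 2\<close>
  in the coefficient of the last series to the base \<open>Q ^ 6\<close> of all the theta
  functions.\<close>

lemma qpoch_trisection:
  assumes "norm w < 1"
  shows "qpoch a w = qpoch a (w ^ 3) * qpoch (a * w) (w ^ 3) * qpoch (a * w ^ 2) (w ^ 3)"
proof -
  have w3: "norm (w ^ 3) < 1"
    using assms by (simp add: norm_power power_less_one_iff)
  have "(\<lambda>n. (\<Prod>k<n. 1 - a * (w ^ 3) ^ k) * (\<Prod>k<n. 1 - a * w * (w ^ 3) ^ k)
          * (\<Prod>k<n. 1 - a * w ^ 2 * (w ^ 3) ^ k))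
        \<longlonglongrightarrow> qpoch a (w ^ 3) * qpoch (a * w) (w ^ 3) * qpoch (a * w ^ 2) (w ^ 3)"
    by (intro tendsto_intros qpoch_LIMSEQ w3)
  moreover have "(\<Prod>k<n. 1 - a * (w ^ 3) ^ k) * (\<Prod>k<n. 1 - a * w * (w ^ 3) ^ k)
          * (\<Prod>k<n. 1 - a * w ^ 2 * (w ^ 3) ^ k) = (\<Prod>k<3 * n. 1 - a * w ^ k)" for n
  proof (induction n)
    case (Suc n)
    have eq: "{..<3 * Suc n} = insert (3 * n + 2) (insert (3 * n + 1) (insert (3 * n) {..<3 * n}))"
      by auto
    have pow: "w ^ (3 * n) = (w ^ 3) ^ n" "w ^ (3 * n + 1) = w * (w ^ 3) ^ n"
      "w ^ (3 * n + 2) = w ^ 2 * (w ^ 3) ^ n"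
      by (simp_all add: power_mult power_add power2_eq_square)
    have "(\<Prod>k<3 * Suc n. 1 - a * w ^ k) = (1 - a * w ^ (3 * n + 2)) * ((1 - a * w ^ (3 * n + 1))
        * ((1 - a * w ^ (3 * n)) * (\<Prod>k<3 * n. 1 - a * w ^ k)))"
      unfolding eq by simp
    then show ?case
      unfolding pow Suc[symmetric] by (simp only: prod.lessThan_Suc mult_ac)
  qed simp
  moreover have "(\<lambda>n. \<Prod>k<3 * n. 1 - a * w ^ k) \<longlonglongrightarrow> qpoch a w"
    using LIMSEQ_subseq_LIMSEQ[OF qpoch_LIMSEQ[OF assms], of "\<lambda>n. 3 * n"]
    by (auto simp: strict_mono_def o_def)
  ultimately show ?thesis
    using LIMSEQ_unique by force
qed

lemma qpoch_holomorphic: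
  assumes "norm p < 1"
  shows "(\<lambda>a. qpoch a p) holomorphic_on UNIV"
proof (rule holomorphic_uniform_sequence[where f = "\<lambda>n a. \<Prod>k<n. 1 - a * p ^ k"])
  fix x :: complex
  have "uniformly_convergent_on (cball x 1) (\<lambda>n a. \<Prod>k<n. 1 + (- (a * p ^ k)))"
  proof (rule uniformly_convergent_on_prod)
    show "uniformly_convergent_on (cball x 1) (\<lambda>n a. \<Sum>k<n. norm (- (a * p ^ k)))"
    proof (rule Weierstrass_m_test')
      show "norm (norm (- (a * p ^ n))) \<le> (norm x + 1) * norm p ^ n" if "a \<in> cball x 1" for n a
      proof -
        have "norm a \<le> norm x + 1"
          using that norm_triangle_ineq2[of a x] by (simp add: dist_norm norm_minus_commute)
        then show ?thesis
          by (simp add: norm_mult norm_power mult_right_mono)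
      qed
      show "summable (\<lambda>n. (norm x + 1) * norm p ^ n)"
        using assms by (intro summable_mult summable_geometric) simp
    qed
  qed (auto intro!: continuous_intros)
  then obtain g where g: "uniform_limit (cball x 1) (\<lambda>n a. \<Prod>k<n. 1 - a * p ^ k) g sequentially"
    by (auto simp: uniformly_convergent_on_def)
  have "g a = qpoch a p" if "a \<in> cball x 1" for a
    using tendsto_uniform_limitI[OF g that] qpoch_LIMSEQ[OF assms] LIMSEQ_unique by blast
  then have "uniform_limit (cball x 1) (\<lambda>n a. \<Prod>k<n. 1 - a * p ^ k) (\<lambda>a. qpoch a p) sequentially"
    by (intro iffD1[OF uniform_limit_cong' g]) auto
  then show "\<exists>d>0. cball x d \<subseteq> UNIV \<and>
      uniform_limit (cball x d) (\<lambda>n a. \<Prod>k<n. 1 - a * p ^ k) (\<lambda>a. qpoch a p) sequentially"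
    by (intro exI[of _ 1]) auto
qed (auto intro!: holomorphic_intros)

lemma qpoch_analytic [analytic_intros]:
  assumes "norm p < 1" "f analytic_on A"
  shows "(\<lambda>x. qpoch (f x) p) analytic_on A"
proof -
  have "(\<lambda>a. qpoch a p) analytic_on UNIV"
    using qpoch_holomorphic[OF assms(1)] by (simp add: analytic_on_open)
  then show ?thesis
    using analytic_on_compose[OF assms(2), of "\<lambda>a. qpoch a p"]
    by (auto simp: o_def intro: analytic_on_subset)
qed

section \<open>The modified Jacobi theta function, that is \<open>qbracket [z] p\<close>: functional
  equations and zeros\<close>

definition theta :: "complex \<Rightarrow> complex \<Rightarrow> complex" where
  "theta p z = qpoch z p * qpoch (p / z) p"

locale nome =
  fixes p :: complex
  assumes p_nz: "p \<noteq> 0" and norm_p: "norm p < 1"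
begin

lemma theta_analytic [analytic_intros]:
  assumes "f analytic_on A" "\<And>x. x \<in> A \<Longrightarrow> f x \<noteq> 0"
  shows "(\<lambda>x. theta p (f x)) analytic_on A"
  unfolding theta_def using assms by (auto intro!: analytic_intros simp: norm_p)

lemma theta_reflect: "theta p (p / z) = theta p z"
  using p_nz by (simp add: theta_def)

lemma theta_inverse:
  assumes "z \<noteq> 0"
  shows "theta p (1 / z) = - theta p z / z"
proof -
  have "theta p (1 / z) = (1 - 1 / z) * qpoch (p / z) p * qpoch (p * z) p"
    using qpoch_rec[OF norm_p, of "1 / z"] by (simp add: theta_def mult_ac)
  moreover have "theta p z = (1 - z) * qpoch (p * z) p * qpoch (p / z) p"
    using qpoch_rec[OF norm_p, of z] by (simp add: theta_def mult_ac)
  moreover have "1 - 1 / z = - ((1 - z) / z)"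
    using assms by (simp add: field_simps)
  ultimately show ?thesis
    by (metis (no_types, lifting) mult.assoc mult.commute mult_minus_left times_divide_eq_left)
qed

lemma theta_shift:
  assumes "z \<noteq> 0"
  shows "theta p (p * z) = - theta p z / z"
  using theta_reflect[of "1 / z"] theta_inverse[OF assms] by simp

lemma theta_factor: "theta p z = (1 - z) * (qpoch (p * z) p * qpoch (p / z) p)"
  using qpoch_rec[OF norm_p, of z] by (simp add: theta_def mult_ac)

text \<open>The factor \<open>qpoch z p\<close> vanishes at the powers of \<open>p\<close> with
  exponent at most 0, the factor \<open>qpoch (p / z) p\<close> at those with positive
  exponent.\<close>

lemma theta_eq_0_iff:
  assumes "z \<noteq> 0"
  shows "theta p z = 0 \<longleftrightarrow> (\<exists>n::int. z = p powi n)"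
proof
  assume "theta p z = 0"
  then consider k where "z * p ^ k = 1" | k where "p / z * p ^ k = 1"
    by (auto simp: theta_def qpoch_eq_0_iff norm_p)
  then show "\<exists>n::int. z = p powi n"
  proof cases
    case 1
    then have "z = p powi (- int k)"
      using p_nz by (simp add: power_int_minus field_simps)
    then show ?thesis ..
  next
    case 2
    then have "z = p powi (int (Suc k))"
      using assms p_nz by (simp add: field_simps del: of_nat_Suc)
    then show ?thesis ..
  qed
next
  assume "\<exists>n::int. z = p powi n"
  then obtain n where z: "z = p powi n" ..
  show "theta p z = 0"
  proof (cases "n > 0")
    case True
    then obtain k where "n = int (Suc k)"
      using zero_less_imp_eq_int by (metis Suc_pred)
    then have "p / z * p ^ k = 1"
      using z p_nz by (simp del: of_nat_Suc)
    then show ?thesis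
      by (auto simp: theta_def qpoch_eq_0_iff norm_p)
  next
    case False
    then obtain k where "n = - int k"
      by (metis int_cases2 of_nat_0_less_iff neg_0_less_iff_less not_gr_zero of_nat_0 minus_zero)
    then have "z * p ^ k = 1"
      using z p_nz by (simp add: power_int_minus)
    then show ?thesis
      by (auto simp: theta_def qpoch_eq_0_iff norm_p)
  qed
qed

lemma qpoch_p_nz: "qpoch p p \<noteq> 0"
proof
  assume "qpoch p p = 0"
  then obtain k where "p ^ Suc k = 1"
    by (auto simp: qpoch_eq_0_iff norm_p)
  then have "norm p ^ Suc k = 1"
    by (metis norm_one norm_power)
  moreover have "norm p ^ Suc k < 1"
    using norm_p by (intro power_Suc_less_one) (auto simp: p_nz)
  ultimately show False by simp
qed

text \<open>No integer power of \<open>p\<close> has norm strictly between \<open>norm p\<close> and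
  1.\<close>

lemma theta_nz_of_norm:
  assumes "norm p < norm z" "norm z < 1"
  shows "theta p z \<noteq> 0"
proof
  assume "theta p z = 0"
  moreover have "z \<noteq> 0" using assms(1) by auto
  ultimately obtain n :: int where n: "norm z = norm p powi n"
    by (auto simp: theta_eq_0_iff norm_power_int)
  have p: "0 < norm p" "norm p < 1" using p_nz norm_p by auto
  show False
  proof (cases "n \<le> 0")
    case True
    have "norm p powi n \<ge> norm p powi 0"
      using p True by (intro power_int_decreasing) auto
    then show False using n assms by simp
  next
    case False
    have "norm p powi n \<le> norm p powi 1"
      using p False by (intro power_int_decreasing) auto
    then show False using n assms by simp
  qed
qed

text \<open>Zeros of an analytic function on the connected set \<open>- {0}\<close> are isolated
  unless it vanishes identically. The number \<open>sqrt (norm p)\<close> lies strictly between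
  \<open>norm p\<close> and 1, hence is a point where theta does not vanish.\<close>

lemma eventually_theta_nz:
  assumes "a \<noteq> 0" "x \<noteq> 0"
  shows "\<forall>\<^sub>F y in at x. theta p (y / a) \<noteq> 0"
proof -
  define r where "r = sqrt (norm p)"
  have p: "0 < norm p" "norm p < 1" using p_nz norm_p by auto
  have r: "0 < r" "r < 1" "norm p < r"
    using p real_less_rsqrt[of "norm p" "norm p"]
    by (auto simp: r_def real_sqrt_lt_1_iff power2_eq_square mult_less_cancel_left1)
  have "theta p (complex_of_real r) \<noteq> 0"
    using r by (intro theta_nz_of_norm) auto
  then have nz: "theta p (a * complex_of_real r / a) \<noteq> 0"
    using assms by simp
  have "(\<lambda>y. theta p (y / a)) analytic_on - {0}"
    using assms by (auto intro!: analytic_intros)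
  then have "(\<lambda>y. theta p (y / a)) holomorphic_on - {0}"
    by (rule analytic_imp_holomorphic)
  then have "\<forall>\<^sub>F y in at x. theta p (y / a) \<noteq> 0 \<and> y \<in> - {0}"
    using nz assms r connected_punctured_universe[of "0::complex"]
    by (intro non_zero_neighbour_alt[where \<beta> = "a * complex_of_real r"]) auto
  then show ?thesis
    by (rule eventually_mono) simp
qed

end

section \<open>A Liouville theorem for q-difference equations\<close>

text \<open>The factor \<open>norm x\<close> beats the constant \<open>K\<close> once \<open>x\<close> is small, so the values on one annulus
  control all values closer to the origin.\<close>

lemma (in nome) bounded_near_0:
  fixes g :: "complex \<Rightarrow> complex"
  assumes cont: "continuous_on (- {0}) g"
    and K: "K > 0" and C: "C \<ge> 0"
    and step: "\<And>x. x \<noteq> 0 \<Longrightarrow> norm x \<le> 1 \<Longrightarrow> norm (g (p * x)) \<le> K * norm x * norm (g x) + C"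
  obtains B r where "r > 0" "\<And>x. x \<noteq> 0 \<Longrightarrow> norm x \<le> r \<Longrightarrow> norm (g x) \<le> B"
proof -
  \<comment> \<open>Chosen so that \<open>K * r \<le> 1 / 2\<close>: a bound B on one annulus then
    passes to the next one inwards as soon as B / 2 + C is at most B, which explains the
    \<open>2 * C\<close> in B below.\<close>
  define r where "r = min 1 (1 / (2 * K))"
  have r: "r > 0" "r \<le> 1" "K * r \<le> 1 / 2"
    using K by (auto simp: r_def min_def field_simps)
  define A where "A = {x::complex. norm p * r \<le> norm x \<and> norm x \<le> r}"
  have pr: "norm p * r > 0" using r p_nz by simp
  have "A = cball 0 r - ball 0 (norm p * r)"
    by (auto simp: A_def)
  then have "compact A"
    by (simp add: compact_diff)
  moreover have "A \<subseteq> - {0}"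
    using pr by (auto simp: A_def)
  ultimately have "bounded (g ` A)"
    by (intro compact_imp_bounded compact_continuous_image continuous_on_subset[OF cont])
  then obtain M where M: "\<And>x. x \<in> A \<Longrightarrow> norm (g x) \<le> M"
    by (auto simp: bounded_iff)
  define B where "B = max M (2 * C)"
  have *: "norm (g x) \<le> B" if "norm p ^ Suc n * r \<le> norm x" "norm x \<le> norm p ^ n * r" for n x
    using that
  proof (induction n arbitrary: x)
    case 0
    then show ?case using M[of x] by (auto simp: A_def B_def)
  next
    case (Suc n)
    define y where "y = x / p"
    have x: "x = p * y" using p_nz by (simp add: y_def)
    have y: "norm p ^ Suc n * r \<le> norm y" "norm y \<le> norm p ^ n * r"
      using Suc.prems p_nz by (auto simp: x norm_mult mult.assoc)
    have "norm p ^ n \<le> 1"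
      using norm_p by (simp add: power_le_one)
    then have yr: "norm y \<le> r"
      using y(2) r(1) mult_right_mono[of "norm p ^ n" 1 r] by linarith
    have "norm p ^ Suc n * r > 0"
      using r p_nz by simp
    then have "y \<noteq> 0"
      using y by auto
    then have "norm (g x) \<le> K * norm y * norm (g y) + C"
      unfolding x using yr r by (intro step) auto
    also have "\<dots> \<le> K * r * B + C"
      using Suc.IH[OF y] yr K r by (intro add_right_mono mult_mono) auto
    also have "\<dots> \<le> 1 / 2 * B + C"
      using r C by (intro add_right_mono mult_right_mono) (auto simp: B_def)
    also have "\<dots> \<le> B"
      by (simp add: B_def)
    finally show ?case .
  qed
  have "norm (g x) \<le> B" if "x \<noteq> 0" "norm x \<le> r" for x
  proof -
    have "(\<lambda>n. norm p ^ n * r) \<longlonglongrightarrow> 0 * r"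
      using norm_p by (intro tendsto_intros LIMSEQ_power_zero) auto
    then have "\<forall>\<^sub>F n in sequentially. norm p ^ n * r < norm x"
      using that by (intro order_tendstoD) auto
    then obtain n0 where "norm p ^ n0 * r < norm x"
      by (auto simp: eventually_sequentially)
    then have ex: "\<exists>n. norm p ^ n * r \<le> norm x"
      by (intro exI[of _ n0]) simp
    \<comment> \<open>The least such n picks the annulus that contains x.\<close>
    define n where "n = (LEAST n. norm p ^ n * r \<le> norm x)"
    have n: "norm p ^ n * r \<le> norm x"
      unfolding n_def using ex by (rule LeastI_ex)
    show ?thesis
    proof (cases n)
      case 0
      then show ?thesis
        using n that norm_p r by (intro *[of 0]) (auto intro: order_trans[OF mult_right_mono])
    next
      case (Suc m)
      then have "\<not> norm p ^ m * r \<le> norm x"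
        unfolding n_def using not_less_Least[of m "\<lambda>n. norm p ^ n * r \<le> norm x"] by simp
      then show ?thesis
        using n Suc by (intro *[of m]) auto
    qed
  qed
  with r show ?thesis using that by blast
qed

text \<open>The product g(x) = (1 - x / a) f(x) extends analytically to a with value 0, and f is - a
  times the difference quotient of g at a. So f tends to - a g'(a). This turns a vanishing residue
  into a removable singularity.\<close>

lemma tendsto_of_simple_zero:
  fixes f :: "complex \<Rightarrow> complex"
  assumes "isolated_singularity_at f a" "((\<lambda>x. (1 - x / a) * f x) \<longlongrightarrow> 0) (at a)" "a \<noteq> 0"
  obtains l where "(f \<longlongrightarrow> l) (at a)"
proof -
  define g where "g = (\<lambda>x. (1 - x / a) * f x)"
  have "isolated_singularity_at g a"
    unfolding g_def using assms by (auto intro!: singularity_intros analytic_intros)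
  with assms have an: "remove_sings g analytic_on {a}"
    by (intro remove_sings_analytic_at[of _ _ 0]) (auto simp: g_def)
  have ga: "remove_sings g a = 0"
    using assms by (intro remove_sings_eqI) (simp add: g_def)
  have ev: "\<forall>\<^sub>F x in at a. remove_sings g x = g x"
    by (rule eventually_remove_sings_eq_at) fact
  have "(remove_sings g has_field_derivative deriv (remove_sings g) a) (at a)"
    using an analytic_on_imp_differentiable_at field_differentiable_derivI by blast
  then have "((\<lambda>x. (remove_sings g x - remove_sings g a) / (x - a)) \<longlongrightarrow> deriv (remove_sings g) a) (at a)"
    by (simp add: has_field_derivative_iff)
  then have "((\<lambda>x. - a * ((remove_sings g x - remove_sings g a) / (x - a)))
      \<longlongrightarrow> - a * deriv (remove_sings g) a) (at a)"
    by (intro tendsto_intros)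
  moreover have "\<forall>\<^sub>F x in at a. - a * ((remove_sings g x - remove_sings g a) / (x - a)) = f x"
    using ev eventually_neq_at_within[of a a]
  proof eventually_elim
    case (elim x)
    then have "remove_sings g x = (1 - x / a) * f x"
      by (simp only: g_def)
    then show ?case
      unfolding ga using assms(3) elim(2) by (simp add: field_simps)
  qed
  ultimately show ?thesis
    by (rule that[OF Lim_transform_eventually])
qed

lemma (in nome) filtermap_times_at: "filtermap ((*) p) (at x) = at (p * x)"
proof -
  have "bij ((*) p)"
    using p_nz by (intro bij_betwI[where g = "\<lambda>y. y / p"]) auto
  moreover have "open ((*) p ` S)" if "open S" for S
  proof -
    have "(*) p ` S = (\<lambda>y. y / p) -` S"
    proof (intro equalityI subsetI)
      fix y assume "y \<in> (\<lambda>y. y / p) -` S"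
      then show "y \<in> (*) p ` S"
        using p_nz by (intro image_eqI[of _ _ "y / p"]) auto
    qed (use p_nz in auto)
    then show ?thesis
      using that p_nz by (auto intro!: open_vimage continuous_intros)
  qed
  ultimately have "filtermap ((*) p) (at x within UNIV) = at (p * x) within ((*) p ` UNIV)"
    by (intro filtermap_linear_at_within) (auto intro!: continuous_intros)
  then show ?thesis
    using \<open>bij ((*) p)\<close> by (simp add: bij_is_surj)
qed

text \<open>After removing its singularities, \<open>f\<close> is bounded near \<open>0\<close> and tends
  to \<open>0\<close> at infinity because of the factor \<open>x\<close> in the difference equation.\<close>

lemma (in nome) q_difference_Liouville:
  fixes f :: "complex \<Rightarrow> complex" and A :: "complex set"
  defines "R \<equiv> {x. x \<noteq> 0 \<and> (\<forall>a\<in>A. theta p (x / a) \<noteq> 0)}"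
  assumes A: "finite A" "0 \<notin> A"
    and ana: "f analytic_on R"
    and sing: "\<And>a. a \<in> A \<Longrightarrow> ((\<lambda>x. (1 - x / a) * f x) \<longlongrightarrow> 0) (at a)"
    and diff: "\<And>x. x \<in> R \<Longrightarrow> f (p * x) = k * x * f x + C"
    and k: "k \<noteq> 0" and x: "x \<in> R"
  shows "f x = 0"
proof -
  have evR: "\<forall>\<^sub>F y in at x. y \<in> R" if "x \<noteq> 0" for x
  proof -
    have "\<forall>\<^sub>F y in at x. \<forall>a\<in>A. theta p (y / a) \<noteq> 0"
      using A that by (intro eventually_ball_finite ballI eventually_theta_nz) auto
    moreover have "\<forall>\<^sub>F y in at x. y \<noteq> 0"
      using that by (intro eventually_neq_at_within)
    ultimately show ?thesis
      by eventually_elim (auto simp: R_def)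
  qed
  have iso: "isolated_singularity_at f x" if x: "x \<noteq> 0" for x
  proof -
    obtain S where S: "open S" "x \<in> S" "\<And>y. y \<in> S \<Longrightarrow> y \<noteq> x \<Longrightarrow> y \<in> R"
      using evR[OF x] by (auto simp: eventually_at_topological)
    have "f analytic_on S - {x}"
      using S by (intro analytic_on_subset[OF ana]) auto
    then show ?thesis
      using S isolated_singularity_at_iff_analytic_nhd by blast
  qed
  \<comment> \<open>\<open>up\<close> and \<open>down\<close> carry the existence of a limit from x
    to p x and back. One representative of each orbit therefore decides about the whole
    orbit.\<close>
  have up: "(f \<longlongrightarrow> k * x * l + C) (at (p * x))" if "(f \<longlongrightarrow> l) (at x)" "x \<noteq> 0" for x l
  proof -
    have "((\<lambda>y. k * y * f y + C) \<longlongrightarrow> k * x * l + C) (at x)"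
      by (intro tendsto_intros that)
    moreover have "\<forall>\<^sub>F y in at x. k * y * f y + C = f (p * y)"
      using evR[OF that(2)] by eventually_elim (simp add: diff)
    ultimately have "((\<lambda>y. f (p * y)) \<longlongrightarrow> k * x * l + C) (at x)"
      by (simp add: tendsto_cong)
    then show ?thesis
      by (simp add: filterlim_def filtermap_filtermap flip: filtermap_times_at)
  qed
  have down: "\<exists>l. (f \<longlongrightarrow> l) (at x)" if "(f \<longlongrightarrow> l) (at (p * x))" "x \<noteq> 0" for x l
  proof -
    have "((\<lambda>y. f (p * y)) \<longlongrightarrow> l) (at x)"
      using that(1) by (simp add: filterlim_def filtermap_filtermap flip: filtermap_times_at)
    then have "((\<lambda>y. (f (p * y) - C) / (k * y)) \<longlongrightarrow> (l - C) / (k * x)) (at x)"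
      using that k by (intro tendsto_intros) auto
    moreover have "\<forall>\<^sub>F y in at x. (f (p * y) - C) / (k * y) = f y"
      using evR[OF that(2)] by eventually_elim (use k in \<open>auto simp: diff R_def\<close>)
    ultimately show ?thesis
      by (auto simp: tendsto_cong)
  qed
  have orbit: "\<exists>l. (f \<longlongrightarrow> l) (at (a * p powi n))" if "a \<in> A" for a and n :: int
  proof (induction n rule: int_induct[where k = 0])
    case base
    have "a \<noteq> 0" using that A by auto
    then show ?case
      using tendsto_of_simple_zero[OF iso sing] that by (metis mult_1_right power_int_0_right)
  next
    case (step1 i)
    then obtain l where "(f \<longlongrightarrow> l) (at (a * p powi i))" by blast
    moreover have "a * p powi i \<noteq> 0"
      using that A p_nz by auto
    moreover have "a * p powi (i + 1) = p * (a * p powi i)"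
      using p_nz by (simp add: power_int_add)
    ultimately show ?case
      using up by metis
  next
    case (step2 i)
    then obtain l where "(f \<longlongrightarrow> l) (at (a * p powi i))" by blast
    moreover have "a * p powi (i - 1) \<noteq> 0"
      using that A p_nz by auto
    moreover have "a * p powi i = p * (a * p powi (i - 1))"
      using p_nz by (simp add: power_int_diff)
    ultimately show ?case
      using down by metis
  qed
  have lim: "\<exists>l. (f \<longlongrightarrow> l) (at x)" if "x \<noteq> 0" for x
  proof (cases "x \<in> R")
    case True
    then have "f analytic_on {x}"
      using ana analytic_on_subset by blast
    then show ?thesis
      using analytic_at_imp_isCont isContD by blast
  next
    case False
    then obtain a where a: "a \<in> A" "theta p (x / a) = 0"
      using \<open>x \<noteq> 0\<close> by (auto simp: R_def)
    then have "a \<noteq> 0" using A by auto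
    then obtain n :: int where "x / a = p powi n"
      using a \<open>x \<noteq> 0\<close> theta_eq_0_iff[of "x / a"] by auto
    then have "x = a * p powi n"
      using \<open>a \<noteq> 0\<close> by (simp add: field_simps)
    then show ?thesis
      using orbit a by blast
  qed
  define g where "g = remove_sings f"
  have fg: "(f \<longlongrightarrow> g x) (at x)" if "x \<noteq> 0" for x
    using lim[OF that] remove_sings_eqI unfolding g_def by blast
  have g_ana: "g analytic_on {x}" if "x \<noteq> 0" for x
    unfolding g_def using lim[OF that] iso[OF that] remove_sings_analytic_at by blast
  then have "g analytic_on - {0}"
    by (subst analytic_on_analytic_at) auto
  then have g_hol: "g holomorphic_on - {0}"
    by (rule analytic_imp_holomorphic)
  have g_diff: "g (p * x) = k * x * g x + C" if "x \<noteq> 0" for x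
    using up[OF fg[OF that] that] fg[of "p * x"] that p_nz LIM_unique by auto
  have cont: "continuous_on (- {0}) g"
    using g_hol holomorphic_on_imp_continuous_on by blast
  obtain B r where B: "r > 0" "\<And>x. x \<noteq> 0 \<Longrightarrow> norm x \<le> r \<Longrightarrow> norm (g x) \<le> B"
  proof (rule bounded_near_0[of g "norm k" "norm C"])
    show "norm (g (p * x)) \<le> norm k * norm x * norm (g x) + norm C" if "x \<noteq> 0" for x
      using that norm_triangle_ineq[of "k * x * g x" C] by (simp add: g_diff norm_mult)
  qed (use cont k in auto)
  have "\<forall>\<^sub>F x in at 0. norm (g x) \<le> B"
    unfolding eventually_at using B by (intro exI[of _ r]) auto
  then obtain h where h: "h holomorphic_on UNIV" "\<And>z. z \<noteq> 0 \<Longrightarrow> h z = g z"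
    using holomorphic_on_extend_bounded[of g UNIV 0] g_hol by (auto simp: Compl_eq_Diff_UNIV)
  \<comment> \<open>Solved for g(1 / (p x)), this has the shape required by
    \<open>bounded_near_0\<close> for the function x -> g(1 / x), now with K = |p / k|. Boundedness
    near infinity thus follows from the same lemma as boundedness near 0.\<close>
  have inv_diff: "g (1 / x) = k / (p * x) * g (1 / (p * x)) + C" if "x \<noteq> 0" for x
    using g_diff[of "1 / (p * x)"] that p_nz by simp
  obtain B' r' where B': "r' > 0" "\<And>x. x \<noteq> 0 \<Longrightarrow> norm x \<le> r' \<Longrightarrow> norm (g (1 / x)) \<le> B'"
  proof (rule bounded_near_0[of "\<lambda>x. g (1 / x)" "norm (p / k)" "norm (p * C / k)"])
    show "continuous_on (- {0}) (\<lambda>x. g (1 / x))"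
      by (intro continuous_on_compose2[OF cont] continuous_intros) auto
    show "norm (g (1 / (p * x))) \<le> norm (p / k) * norm x * norm (g (1 / x)) + norm (p * C / k)"
      if "x \<noteq> 0" "norm x \<le> 1" for x
    proof -
      have "g (1 / (p * x)) = p / k * x * g (1 / x) - p * C / k * x"
        using inv_diff[OF that(1)] that k p_nz by (simp add: field_simps)
      also have "norm \<dots> \<le> norm (p / k * x * g (1 / x)) + norm (p * C / k * x)"
        by (rule norm_triangle_ineq4)
      also have "norm (p * C / k * x) \<le> norm (p * C / k) * 1"
        unfolding norm_mult[of _ x] using that by (intro mult_left_mono) auto
      finally show ?thesis
        by (simp only: norm_mult mult_1_right)
    qed
    show "0 < norm (p / k)" "0 \<le> norm (p * C / k)"
      using k p_nz by auto
  qed blast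
  \<comment> \<open>Boundedness alone would leave a constant. One more use of the equation writes
    g(1 / x) as x times a bounded quantity, which forces the limit 0.\<close>
  have "((\<lambda>x. h (inverse x)) \<longlongrightarrow> 0) (at 0)"
  proof (rule Lim_null_comparison)
    show "\<forall>\<^sub>F x in at 0. norm (h (inverse x)) \<le> norm x * ((B' + norm C) / norm k)"
      unfolding eventually_at
    proof (intro exI[of _ "norm p * r'"] conjI ballI impI)
      fix x :: complex
      assume x: "x \<noteq> 0 \<and> dist x 0 < norm p * r'"
      then have "norm (g (1 / (x / p))) \<le> B'"
        using p_nz by (intro B'(2)) (auto simp: norm_divide field_simps)
      then have "norm (g (p / x) - C) \<le> B' + norm C"
        using norm_triangle_ineq4[of "g (p / x)" C] by simp
      moreover have "g (1 / x) = x * ((g (p / x) - C) / k)"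
        using g_diff[of "1 / x"] x k by (simp add: field_simps)
      moreover have "h (inverse x) = g (1 / x)"
        using x by (simp add: h(2) inverse_eq_divide)
      ultimately show "norm (h (inverse x)) \<le> norm x * ((B' + norm C) / norm k)"
        by (simp add: norm_mult norm_divide mult_left_mono divide_right_mono)
    qed (use B'(1) p_nz in auto)
    show "((\<lambda>x. norm x * ((B' + norm C) / norm k)) \<longlongrightarrow> 0) (at 0)"
      using k by (auto intro!: tendsto_eq_intros)
  qed
  then have "(h \<longlongrightarrow> 0) at_infinity"
    by (simp add: lim_at_infinity_0 o_def)
  then have "h x = 0"
    using Liouville_weak h(1) by blast
  moreover have "f analytic_on {x}"
    by (rule analytic_on_subset[OF ana]) (use x in auto)
  moreover have "x \<noteq> 0"
    using x by (simp add: R_def)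
  ultimately show ?thesis
    using h(2)[of x] by (simp add: g_def)
qed

section \<open>Partial fraction series and Lambert series\<close>

text \<open>Moving z by at most \<delta> / 2 changes z c by at most \<delta> |c| / 2. The weight 1 +
  |c| in the gap condition absorbs this even when the c are unbounded, as they are for negative
  powers of p.\<close>

lemma partial_fraction_denominator:
  fixes c z z0 :: complex
  assumes "\<delta> > 0" "\<delta> * (1 + norm c) \<le> norm (1 - z0 * c)" "z \<in> cball z0 (\<delta> / 2)"
  shows "norm (1 - z * c) \<ge> \<delta> / 2"
proof -
  have "norm ((z0 - z) * c) \<le> \<delta> / 2 * norm c"
    unfolding norm_mult using assms(3) by (intro mult_right_mono) (auto simp: dist_norm)
  moreover have "norm (1 - z0 * c) \<le> norm (1 - z * c) + norm ((z0 - z) * c)"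
    using norm_triangle_ineq4[of "1 - z * c" "(z0 - z) * c"] by (simp add: algebra_simps)
  moreover have "\<delta> / 2 * norm c \<ge> 0"
    using assms(1) by simp
  ultimately show ?thesis
    using assms(1,2) unfolding distrib_left mult_1_right by linarith
qed

text \<open>The gap condition gives a Weierstrass majorant 2 |a i| / \<delta> on a disc around z0.
  It is demanded only where \<open>a i \<noteq> 0\<close>, so terms with numerator 0 may have any
  denominator.\<close>

lemma
  fixes a c :: "'i \<Rightarrow> complex" and z0 :: complex
  assumes a: "(\<lambda>i. norm (a i)) summable_on I" and \<delta>: "\<delta> > 0"
    and gap: "\<And>i. i \<in> I \<Longrightarrow> a i \<noteq> 0 \<Longrightarrow> \<delta> * (1 + norm (c i)) \<le> norm (1 - z0 * c i)"
  shows partial_fraction_sum_analytic: "(\<lambda>z. \<Sum>\<^sub>\<infinity>i\<in>I. a i / (1 - z * c i)) analytic_on {z0}"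
    and partial_fraction_sum_abs_summable: "(\<lambda>i. norm (a i / (1 - z0 * c i))) summable_on I"
proof -
  have bound: "norm (a i / (1 - z * c i)) \<le> norm (a i) * (2 / \<delta>)"
    if "i \<in> I" "z \<in> cball z0 (\<delta> / 2)" for i z
  proof (cases "a i = 0")
    case False
    have "norm (1 - z * c i) \<ge> \<delta> / 2"
      using partial_fraction_denominator[OF \<delta> gap[OF that(1) False] that(2)] .
    then have "norm (a i) / norm (1 - z * c i) \<le> norm (a i) / (\<delta> / 2)"
      using \<delta> by (intro divide_left_mono mult_pos_pos) auto
    then show ?thesis
      by (simp add: norm_divide)
  qed simp
  have summ: "(\<lambda>i. norm (a i) * (2 / \<delta>)) summable_on I"
    using a by (intro summable_on_cmult_left)
  show "(\<lambda>i. norm (a i / (1 - z0 * c i))) summable_on I"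
    using \<delta> by (intro Infinite_Sum.abs_summable_on_comparison_test'[OF summ] bound) auto
  have lim: "uniform_limit (cball z0 (\<delta> / 2)) (\<lambda>X z. \<Sum>i\<in>X. a i / (1 - z * c i))
      (\<lambda>z. \<Sum>\<^sub>\<infinity>i\<in>I. a i / (1 - z * c i)) (finite_subsets_at_top I)"
    using bound summ by (intro Weierstrass_m_test_general) auto
  have "\<forall>\<^sub>F X in finite_subsets_at_top I.
      continuous_on (cball z0 (\<delta> / 2)) (\<lambda>z. \<Sum>i\<in>X. a i / (1 - z * c i)) \<and>
      (\<lambda>z. \<Sum>i\<in>X. a i / (1 - z * c i)) holomorphic_on ball z0 (\<delta> / 2)"
  proof (rule eventually_finite_subsets_at_top_weakI)
    fix X assume X: "finite X" "X \<subseteq> I"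
    have "(\<lambda>z. a i / (1 - z * c i)) holomorphic_on cball z0 (\<delta> / 2)" if "i \<in> X" for i
    proof (cases "a i = 0")
      case False
      have "1 - z * c i \<noteq> 0" if "z \<in> cball z0 (\<delta> / 2)" for z
        using partial_fraction_denominator[OF \<delta> gap[of i] that] \<open>i \<in> X\<close> X False \<delta> by auto
      then show ?thesis
        by (intro holomorphic_intros) auto
    qed auto
    then have "(\<lambda>z. \<Sum>i\<in>X. a i / (1 - z * c i)) holomorphic_on cball z0 (\<delta> / 2)"
      by (rule holomorphic_on_sum)
    then show "continuous_on (cball z0 (\<delta> / 2)) (\<lambda>z. \<Sum>i\<in>X. a i / (1 - z * c i)) \<and>
        (\<lambda>z. \<Sum>i\<in>X. a i / (1 - z * c i)) holomorphic_on ball z0 (\<delta> / 2)"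
      by (blast intro: holomorphic_on_imp_continuous_on holomorphic_on_subset[OF _ ball_subset_cball])
  qed
  then have "(\<lambda>z. \<Sum>\<^sub>\<infinity>i\<in>I. a i / (1 - z * c i)) holomorphic_on ball z0 (\<delta> / 2)"
    by (rule holomorphic_uniform_limit[OF _ lim finite_subsets_at_top_neq_bot])
  then show "(\<lambda>z. \<Sum>\<^sub>\<infinity>i\<in>I. a i / (1 - z * c i)) analytic_on {z0}"
    using \<delta> by (intro analytic_on_subset[OF iffD2[OF analytic_on_open]]) auto
qed

section \<open>Distance of the points z p^n from 1, and Lambert series\<close>

context nome
begin

text \<open>The quotient of the two norms tends to 1 because p^n tends to 0, so it exceeds 1/2 for
  all but finitely many n. The finitely many positive values left over have a positive
  minimum.\<close>

lemma power_gap: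
  fixes z :: complex
  obtains \<delta> where "\<delta> > 0" "\<And>n. z * p ^ n \<noteq> 1 \<Longrightarrow> \<delta> * (1 + norm (p ^ n)) \<le> norm (1 - z * p ^ n)"
proof -
  define f where "f = (\<lambda>n. norm (1 - z * p ^ n) / (1 + norm (p ^ n)))"
  have "(\<lambda>n. p ^ n) \<longlonglongrightarrow> 0"
    using norm_p by (rule LIMSEQ_power_zero)
  then have "f \<longlonglongrightarrow> norm (1 - z * 0) / (1 + norm (0::complex))"
    unfolding f_def by (intro tendsto_intros norm_p) auto
  then have "\<forall>\<^sub>F n in sequentially. f n > 1 / 2"
    by (intro order_tendstoD) auto
  then obtain N where N: "\<And>n. n \<ge> N \<Longrightarrow> f n > 1 / 2"
    by (auto simp: eventually_sequentially)
  define D where "D = insert (1 / 2) (f ` {n. n < N \<and> z * p ^ n \<noteq> 1})"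
  have fin: "finite D" "D \<noteq> {}"
    by (auto simp: D_def)
  have pos: "1 + norm (p ^ n) > 0" for n
    by (rule add_pos_nonneg) auto
  then have "f n > 0" if "z * p ^ n \<noteq> 1" for n
    using that by (auto simp: f_def)
  then have "Min D > 0"
    using fin by (auto simp: D_def)
  moreover have "Min D * (1 + norm (p ^ n)) \<le> norm (1 - z * p ^ n)" if "z * p ^ n \<noteq> 1" for n
  proof -
    have "Min D \<le> f n"
    proof (cases "n < N")
      case True
      then show ?thesis
        using that fin by (intro Min_le) (auto simp: D_def)
    next
      case False
      have "Min D \<le> 1 / 2"
        using fin by (intro Min_le) (auto simp: D_def)
      then show ?thesis using N[of n] False by simp
    qed
    then show ?thesis
      using pos[of n] by (simp add: f_def pos_le_divide_eq)
  qed
  ultimately show ?thesis using that by blast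
qed

text \<open>For a negative exponent - k, the identity 1 - z / p^k = - (z / p^k) (1 - p^k / z)
  reduces the claim to \<open>power_gap\<close> at 1 / z. The factor 1 / |p^k| is exactly what turns
  1 + |p^k| into 1 + |p^(-k)|.\<close>

lemma power_int_gap:
  fixes z :: complex
  assumes "z \<noteq> 0"
  obtains \<delta> where "\<delta> > 0"
    "\<And>n::int. z * p powi n \<noteq> 1 \<Longrightarrow> \<delta> * (1 + norm (p powi n)) \<le> norm (1 - z * p powi n)"
proof -
  obtain d1 where d1: "d1 > 0"
    "\<And>n. z * p ^ n \<noteq> 1 \<Longrightarrow> d1 * (1 + norm (p ^ n)) \<le> norm (1 - z * p ^ n)"
    using power_gap[of z] by blast
  obtain d2 where d2: "d2 > 0"
    "\<And>n. 1 / z * p ^ n \<noteq> 1 \<Longrightarrow> d2 * (1 + norm (p ^ n)) \<le> norm (1 - 1 / z * p ^ n)"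
    using power_gap[of "1 / z"] by blast
  define d where "d = min d1 (norm z * d2)"
  have "d * (1 + norm (p powi n)) \<le> norm (1 - z * p powi n)" if n: "z * p powi n \<noteq> 1" for n :: int
  proof (cases "n \<ge> 0")
    case True
    then obtain k where k: "n = int k" by (metis nonneg_int_cases)
    have "d * (1 + norm (p ^ k)) \<le> d1 * (1 + norm (p ^ k))"
      by (intro mult_right_mono) (auto simp: d_def)
    then show ?thesis using d1(2)[of k] n k by auto
  next
    case False
    then obtain k where k: "n = - int k" by (metis int_cases2 nle_le of_nat_0_le_iff)
    have pk: "p ^ k \<noteq> 0" using p_nz by simp
    have pn: "p powi n = 1 / p ^ k"
      by (simp add: k power_int_minus divide_simps)
    have "1 / z * p ^ k \<noteq> 1"
      using n assms pk by (auto simp: pn field_simps)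
    then have *: "d2 * (1 + norm (p ^ k)) \<le> norm (1 - 1 / z * p ^ k)"
      by (rule d2(2))
    have "1 - z * p powi n = - (z / p ^ k) * (1 - 1 / z * p ^ k)"
      using assms pk by (simp add: pn field_simps)
    then have eq: "norm (1 - z * p powi n) = norm z / norm (p ^ k) * norm (1 - 1 / z * p ^ k)"
      by (simp only: norm_mult norm_divide norm_minus_cancel)
    have "d * (1 + norm (p powi n)) \<le> norm z * d2 * (1 + norm (p powi n))"
      by (intro mult_right_mono) (auto simp: d_def)
    also have "\<dots> = norm z / norm (p ^ k) * (d2 * (1 + norm (p ^ k)))"
      using pk by (simp add: pn norm_divide field_simps)
    also have "\<dots> \<le> norm (1 - z * p powi n)"
      unfolding eq by (intro mult_left_mono *) auto
    finally show ?thesis .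
  qed
  moreover have "d > 0" using d1 d2 assms by (simp add: d_def)
  ultimately show ?thesis using that by blast
qed

text \<open>The Lambert series with terms z p^m / (1 - z p^m). The factor z stands outside so that
  the sum is a partial fraction sum with numerators independent of z.\<close>

definition lambert :: "complex \<Rightarrow> complex" where
  "lambert z = z * (\<Sum>\<^sub>\<infinity>m::nat. p ^ m / (1 - z * p ^ m))"

lemma power_abs_summable: "(\<lambda>m::nat. norm (p ^ m)) summable_on UNIV"
proof -
  have "summable (\<lambda>m. norm (p ^ m))"
    using norm_p by (simp add: norm_power summable_geometric)
  then show ?thesis
    by (simp add: summable_on_UNIV_nonneg_real_iff)
qed

lemma lambert_abs_summable: "(\<lambda>m::nat. norm (p ^ m / (1 - z * p ^ m))) summable_on UNIV"
proof -
  obtain \<delta> where \<delta>: "\<delta> > 0"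
    "\<And>n. z * p ^ n \<noteq> 1 \<Longrightarrow> \<delta> * (1 + norm (p ^ n)) \<le> norm (1 - z * p ^ n)"
    using power_gap[of z] by blast
  \<comment> \<open>Division by 0 yields 0, so a term with vanishing denominator is 0 anyway.
    Replacing its numerator by 0 exempts it from the gap condition, and the series converges for
    every z, poles included.\<close>
  define a where "a = (\<lambda>m::nat. if z * p ^ m = 1 then 0 else p ^ m)"
  have "(\<lambda>m. norm (a m)) summable_on UNIV"
    by (rule Infinite_Sum.abs_summable_on_comparison_test[OF power_abs_summable]) (simp add: a_def)
  then have "(\<lambda>m. norm (a m / (1 - z * p ^ m))) summable_on UNIV"
    using \<delta> by (intro partial_fraction_sum_abs_summable[where \<delta> = \<delta>]) (auto simp: a_def split: if_splits)
  moreover have "a m / (1 - z * p ^ m) = p ^ m / (1 - z * p ^ m)" for m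
    by (simp add: a_def)
  ultimately show ?thesis by (simp only:)
qed

lemma lambert_has_sum: "((\<lambda>m::nat. z * p ^ m / (1 - z * p ^ m)) has_sum lambert z) UNIV"
proof -
  have "((\<lambda>m::nat. z * (p ^ m / (1 - z * p ^ m))) has_sum lambert z) UNIV"
    unfolding lambert_def
    by (intro has_sum_cmult_right has_sum_infsum abs_summable_summable[OF lambert_abs_summable])
  then show ?thesis by simp
qed

lemma lambert_analytic:
  assumes "\<And>n. z * p ^ n \<noteq> 1"
  shows "lambert analytic_on {z}"
proof -
  obtain \<delta> where \<delta>: "\<delta> > 0"
    "\<And>n. z * p ^ n \<noteq> 1 \<Longrightarrow> \<delta> * (1 + norm (p ^ n)) \<le> norm (1 - z * p ^ n)"
    using power_gap[of z] by blast
  have "(\<lambda>z. \<Sum>\<^sub>\<infinity>m::nat. p ^ m / (1 - z * p ^ m)) analytic_on {z}"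
    using \<delta> assms by (intro partial_fraction_sum_analytic[where \<delta> = \<delta>] power_abs_summable) auto
  then show ?thesis
    unfolding lambert_def by (intro analytic_intros)
qed

lemma lambert_shift: "lambert z = z / (1 - z) + lambert (p * z)"
proof -
  have "(\<lambda>m. z * p ^ m / (1 - z * p ^ m)) sums lambert z"
    by (intro has_sum_imp_sums lambert_has_sum)
  then have "(\<lambda>m. z * p ^ Suc m / (1 - z * p ^ Suc m)) sums (lambert z - z / (1 - z))"
    using sums_split_initial_segment[of _ _ 1] by fastforce
  moreover have "(\<lambda>m. p * z * p ^ m / (1 - p * z * p ^ m)) sums lambert (p * z)"
    by (intro has_sum_imp_sums lambert_has_sum)
  ultimately have "lambert z - z / (1 - z) = lambert (p * z)"
    by (intro sums_unique2) (auto simp: mult_ac)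
  then show ?thesis by (simp add: algebra_simps)
qed

text \<open>This is the logarithmic derivative \<open>- z * \<theta>'(z) / \<theta>(z)\<close> of the theta function.\<close>

definition zeta_sum :: "complex \<Rightarrow> complex" where
  "zeta_sum z = lambert z - lambert (p / z)"

lemma zeta_sum_reflect: "zeta_sum (p / z) = - zeta_sum z"
  using p_nz by (simp add: zeta_sum_def)

lemma zeta_sum_inverse:
  assumes "z \<noteq> 0" "z \<noteq> 1"
  shows "zeta_sum (1 / z) = - zeta_sum z - 1"
proof -
  have "(1 / z) / (1 - 1 / z) = - 1 - z / (1 - z)"
    using assms by (simp add: divide_simps)
  then show ?thesis
    using lambert_shift[of z] lambert_shift[of "1 / z"] by (simp add: zeta_sum_def)
qed

text \<open>The counterpart of \<open>theta_shift\<close> for logarithmic derivatives: the factor 1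
  / z there contributes the summand 1 here.\<close>

lemma zeta_sum_shift:
  assumes "z \<noteq> 0" "z \<noteq> 1"
  shows "zeta_sum (p * z) = zeta_sum z + 1"
  using zeta_sum_reflect[of "1 / z"] zeta_sum_inverse[OF assms] by simp

lemma zeta_sum_analytic_at:
  assumes "z \<noteq> 0" "theta p z \<noteq> 0"
  shows "zeta_sum analytic_on {z}"
proof -
  have 1: "lambert analytic_on {z}"
    using assms by (intro lambert_analytic) (auto simp: theta_def qpoch_eq_0_iff norm_p)
  have "lambert analytic_on {p / z}"
    using assms by (intro lambert_analytic) (auto simp: theta_def qpoch_eq_0_iff norm_p)
  then have "(lambert \<circ> (\<lambda>z. p / z)) analytic_on {z}"
    using assms by (intro analytic_on_compose analytic_intros) auto
  then have "(\<lambda>z. lambert (p / z)) analytic_on {z}"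
    by (simp add: o_def)
  with 1 have "(\<lambda>z. lambert z - lambert (p / z)) analytic_on {z}"
    by (intro analytic_intros)
  then show ?thesis
    by (simp add: zeta_sum_def[abs_def])
qed

lemma zeta_sum_analytic [analytic_intros]:
  assumes "f analytic_on A" "\<And>x. x \<in> A \<Longrightarrow> f x \<noteq> 0" "\<And>x. x \<in> A \<Longrightarrow> theta p (f x) \<noteq> 0"
  shows "(\<lambda>x. zeta_sum (f x)) analytic_on A"
proof -
  have "zeta_sum analytic_on f ` A"
    by (subst analytic_on_analytic_at) (auto intro!: zeta_sum_analytic_at assms)
  then show ?thesis
    using analytic_on_compose[OF assms(1)] by (simp add: o_def)
qed

text \<open>By \<open>lambert_shift\<close> the pole comes from z / (1 - z) alone; both remaining
  Lambert series are evaluated near p, where \<open>lambert\<close> is continuous.\<close>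

lemma zeta_sum_pole: "((\<lambda>z. (1 - z) * zeta_sum z) \<longlongrightarrow> 1) (at 1)"
proof -
  have npow: "p * p ^ n \<noteq> 1" for n
    using qpoch_p_nz by (auto simp: qpoch_eq_0_iff norm_p)
  have lp: "isCont lambert p"
    by (intro analytic_at_imp_isCont lambert_analytic npow)
  have "((\<lambda>z. lambert (p * z)) \<longlongrightarrow> lambert p) (at 1)"
    by (rule isCont_tendsto_compose[OF lp]) (auto intro!: tendsto_eq_intros)
  moreover have "((\<lambda>z. lambert (p / z)) \<longlongrightarrow> lambert p) (at 1)"
    by (rule isCont_tendsto_compose[OF lp]) (auto intro!: tendsto_eq_intros)
  ultimately have "((\<lambda>z. z + (1 - z) * (lambert (p * z) - lambert (p / z)))
      \<longlongrightarrow> 1 + (1 - 1) * (lambert p - lambert p)) (at 1)"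
    by (intro tendsto_intros)
  moreover have "\<forall>\<^sub>F z in at 1. z + (1 - z) * (lambert (p * z) - lambert (p / z)) = (1 - z) * zeta_sum z"
    using eventually_neq_at_within[of 1 1]
  proof eventually_elim
    case (elim z)
    then show ?case
      using lambert_shift[of z] by (simp add: zeta_sum_def field_simps)
  qed
  ultimately show ?thesis
    using Lim_transform_eventually by fastforce
qed

end

section \<open>Appell sums\<close>

locale appell_sums =
  fixes Q :: complex
  assumes Q_nz: "Q \<noteq> 0" and norm_Q: "norm Q < 1"

sublocale appell_sums \<subseteq> nome "Q ^ 6"
  by unfold_locales (use Q_nz norm_Q in \<open>auto simp: norm_power power_less_one_iff\<close>)

lemma (in nome) norm_power_int_eq_1:
  fixes n :: int
  assumes "norm p powi n = 1"
  shows "n = 0"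
proof (rule ccontr)
  assume "n \<noteq> 0"
  then consider "0 < n" | "n < 0" by linarith
  then show False
    using power_int_strict_decreasing[of 0 n "norm p"] power_int_strict_decreasing[of n 0 "norm p"]
      p_nz norm_p assms by cases auto
qed

lemma (in nome) theta_minus_1_nz: "theta p (- 1) \<noteq> 0"
proof
  assume "theta p (- 1) = 0"
  then obtain n :: int where n: "- 1 = p powi n"
    by (auto simp: theta_eq_0_iff)
  then have "norm p powi n = 1"
    by (metis norm_minus_cancel norm_one norm_power_int)
  then show False
    using n norm_power_int_eq_1 by fastforce
qed

context appell_sums
begin

text \<open>A single family covers all the series: sign \<sigma>, linear exponent b and weight
  \<alpha> n + \<beta>. Taking Q rather than Q^2 as base keeps the quadratic exponents free of
  halves.\<close>

definition coeff :: "complex \<Rightarrow> int \<Rightarrow> int \<Rightarrow> int \<Rightarrow> int \<Rightarrow> complex" where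
  "coeff \<sigma> b \<alpha> \<beta> n = of_int (\<alpha> * n + \<beta>) * \<sigma> powi n * Q powi (3 * n * n + b * n)"

definition appell :: "complex \<Rightarrow> int \<Rightarrow> int \<Rightarrow> int \<Rightarrow> complex \<Rightarrow> complex" where
  "appell \<sigma> b \<alpha> \<beta> z = (\<Sum>\<^sub>\<infinity>n. coeff \<sigma> b \<alpha> \<beta> n / (1 - z * (Q ^ 6) powi n))"

text \<open>The n-th term is the n-th power of 2 |Q|^b |Q|^(3 n), which tends to 0, so it is
  eventually below (1/2)^n. The factor 2^n is carried along to dominate the linear weight in
  \<open>coeff\<close>.\<close>

lemma summable_gaussian_nat:
  fixes b :: int
  shows "summable (\<lambda>n. 2 ^ n * norm Q powi (3 * int n * int n + b * int n))"
proof -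
  have Q: "0 < norm Q" "norm Q < 1"
    using Q_nz norm_Q by auto
  have eq: "2 ^ n * norm Q powi (3 * int n * int n + b * int n)
      = (2 * (norm Q powi b * (norm Q ^ 3) ^ n)) ^ n" for n
  proof -
    have "norm Q powi (3 * int n * int n + b * int n) = norm Q powi ((b + int (3 * n)) * int n)"
      by (simp add: algebra_simps)
    also have "\<dots> = (norm Q powi b * (norm Q ^ 3) ^ n) ^ n"
      using Q by (simp add: power_int_mult power_int_add power_mult del: of_nat_mult)
    finally show ?thesis
      by (simp add: power_mult_distrib)
  qed
  have "norm Q ^ 3 < 1"
    using Q by (simp add: power_less_one_iff)
  then have "(\<lambda>n. 2 * (norm Q powi b * (norm Q ^ 3) ^ n)) \<longlonglongrightarrow> 2 * (norm Q powi b * 0)"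
    using Q by (intro tendsto_intros LIMSEQ_power_zero) auto
  then have ev: "\<forall>\<^sub>F n in sequentially. 2 * (norm Q powi b * (norm Q ^ 3) ^ n) < 1 / 2"
    by (rule order_tendstoD(2)) simp
  show ?thesis
    unfolding eq
  proof (rule summable_comparison_test_ev)
    show "\<forall>\<^sub>F n in sequentially. norm ((2 * (norm Q powi b * (norm Q ^ 3) ^ n)) ^ n) \<le> (1 / 2) ^ n"
      using ev
    proof eventually_elim
      case (elim n)
      have "(2 * (norm Q powi b * (norm Q ^ 3) ^ n)) ^ n \<le> (1 / 2) ^ n"
        using elim by (intro power_mono) auto
      then show ?case
        by simp
    qed
  qed (simp add: summable_geometric)
qed

lemma summable_gaussian:
  fixes b :: int
  shows "(\<lambda>n::int. 2 ^ nat \<bar>n\<bar> * norm Q powi (3 * n * n + b * n)) summable_on UNIV"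
proof -
  let ?g = "\<lambda>n::int. 2 ^ nat \<bar>n\<bar> * norm Q powi (3 * n * n + b * n)"
  have "(\<lambda>n. 2 ^ n * norm Q powi (3 * int n * int n + b * int n)) summable_on UNIV"
    using summable_gaussian_nat by (simp add: summable_on_UNIV_nonneg_real_iff)
  then have "(?g \<circ> int) summable_on UNIV"
    by (simp add: o_def)
  then have 1: "?g summable_on range int"
    by (subst summable_on_reindex) auto
  have "(\<lambda>n. 2 ^ n * norm Q powi (3 * int n * int n + (- b) * int n)) summable_on UNIV"
    using summable_gaussian_nat[of "- b"] by (subst summable_on_UNIV_nonneg_real_iff) auto
  then have "(?g \<circ> (\<lambda>n. - int n)) summable_on UNIV"
    by (simp add: o_def)
  then have 2: "?g summable_on range (\<lambda>n. - int n)"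
    by (subst summable_on_reindex) (auto simp: inj_on_def)
  have "?g summable_on (range int \<union> (range (\<lambda>n. - int n) - range int))"
    by (intro summable_on_Un_disjoint 1 summable_on_subset_banach[OF 2]) auto
  moreover have "n \<in> range int \<union> (range (\<lambda>n. - int n) - range int)" for n :: int
    by (cases n rule: int_cases2) auto
  then have "range int \<union> (range (\<lambda>n. - int n) - range int) = UNIV"
    by blast
  ultimately show ?thesis
    by simp
qed

lemma coeff_abs_summable:
  assumes "norm \<sigma> = 1"
  shows "(\<lambda>n. norm (coeff \<sigma> b \<alpha> \<beta> n)) summable_on UNIV"
proof (rule Infinite_Sum.abs_summable_on_comparison_test')
  show "(\<lambda>n. of_int (\<bar>\<alpha>\<bar> + \<bar>\<beta>\<bar>) * (2 ^ nat \<bar>n\<bar> * norm Q powi (3 * n * n + b * n))) summable_on UNIV"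
    by (intro summable_on_cmult_right summable_gaussian)
  show "norm (coeff \<sigma> b \<alpha> \<beta> n)
      \<le> of_int (\<bar>\<alpha>\<bar> + \<bar>\<beta>\<bar>) * (2 ^ nat \<bar>n\<bar> * norm Q powi (3 * n * n + b * n))" for n
  proof -
    have "int (nat \<bar>n\<bar>) < int (2 ^ nat \<bar>n\<bar>)"
      by (subst of_nat_less_iff) (rule less_exp)
    then have n: "\<bar>n\<bar> \<le> 2 ^ nat \<bar>n\<bar>"
      by simp
    have "\<bar>\<alpha> * n + \<beta>\<bar> \<le> \<bar>\<alpha>\<bar> * \<bar>n\<bar> + \<bar>\<beta>\<bar> * 1"
      using abs_triangle_ineq[of "\<alpha> * n" \<beta>] by (simp add: abs_mult)
    also have "\<dots> \<le> \<bar>\<alpha>\<bar> * 2 ^ nat \<bar>n\<bar> + \<bar>\<beta>\<bar> * 2 ^ nat \<bar>n\<bar>"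
      using n by (intro add_mono mult_left_mono) auto
    finally have "\<bar>\<alpha> * n + \<beta>\<bar> \<le> (\<bar>\<alpha>\<bar> + \<bar>\<beta>\<bar>) * 2 ^ nat \<bar>n\<bar>"
      by (simp add: algebra_simps)
    then have "real_of_int \<bar>\<alpha> * n + \<beta>\<bar> \<le> real_of_int ((\<bar>\<alpha>\<bar> + \<bar>\<beta>\<bar>) * 2 ^ nat \<bar>n\<bar>)"
      by (subst of_int_le_iff)
    then have "norm (of_int (\<alpha> * n + \<beta>) :: complex) \<le> of_int (\<bar>\<alpha>\<bar> + \<bar>\<beta>\<bar>) * 2 ^ nat \<bar>n\<bar>"
      by (simp only: norm_of_int of_int_abs of_int_mult of_int_power of_int_numeral)
    then have "norm (of_int (\<alpha> * n + \<beta>) :: complex) * norm Q powi (3 * n * n + b * n)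
        \<le> of_int (\<bar>\<alpha>\<bar> + \<bar>\<beta>\<bar>) * 2 ^ nat \<bar>n\<bar> * norm Q powi (3 * n * n + b * n)"
      by (rule mult_right_mono) simp
    then show ?thesis
      using assms by (simp only: coeff_def norm_mult norm_power_int power_int_1_left mult_1_right mult.assoc)
  qed
qed

lemma appell_abs_summable:
  assumes "norm \<sigma> = 1" "z \<noteq> 0" "theta (Q ^ 6) z \<noteq> 0"
  shows "(\<lambda>n. norm (coeff \<sigma> b \<alpha> \<beta> n / (1 - z * (Q ^ 6) powi n))) summable_on UNIV"
    and "appell \<sigma> b \<alpha> \<beta> analytic_on {z}"
proof -
  obtain \<delta> where \<delta>: "\<delta> > 0" "\<And>n::int. z * (Q ^ 6) powi n \<noteq> 1 \<Longrightarrow>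
      \<delta> * (1 + norm ((Q ^ 6) powi n)) \<le> norm (1 - z * (Q ^ 6) powi n)"
    using power_int_gap[OF assms(2)] by blast
  have ne: "z * (Q ^ 6) powi n \<noteq> 1" for n :: int
  proof
    assume "z * (Q ^ 6) powi n = 1"
    then have "z = (Q ^ 6) powi (- n)"
      using Q_nz by (simp add: power_int_minus field_simps)
    then show False
      using assms theta_eq_0_iff by blast
  qed
  show "(\<lambda>n. norm (coeff \<sigma> b \<alpha> \<beta> n / (1 - z * (Q ^ 6) powi n))) summable_on UNIV"
    by (rule partial_fraction_sum_abs_summable[OF coeff_abs_summable[OF assms(1)] \<delta>(1) \<delta>(2)[OF ne]])
  show "appell \<sigma> b \<alpha> \<beta> analytic_on {z}"
    unfolding appell_def[abs_def]
    by (rule partial_fraction_sum_analytic[OF coeff_abs_summable[OF assms(1)] \<delta>(1) \<delta>(2)[OF ne]])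
qed

lemma appell_has_sum:
  assumes "norm \<sigma> = 1" "z \<noteq> 0" "theta (Q ^ 6) z \<noteq> 0"
  shows "((\<lambda>n. coeff \<sigma> b \<alpha> \<beta> n / (1 - z * (Q ^ 6) powi n)) has_sum appell \<sigma> b \<alpha> \<beta> z) UNIV"
  unfolding appell_def
  by (intro has_sum_infsum abs_summable_summable[OF appell_abs_summable(1)] assms)

lemma appell_analytic [analytic_intros]:
  assumes "norm \<sigma> = 1" "f analytic_on A" "\<And>x. x \<in> A \<Longrightarrow> f x \<noteq> 0"
    "\<And>x. x \<in> A \<Longrightarrow> theta (Q ^ 6) (f x) \<noteq> 0"
  shows "(\<lambda>x. appell \<sigma> b \<alpha> \<beta> (f x)) analytic_on A"
proof -
  have "appell \<sigma> b \<alpha> \<beta> analytic_on f ` A"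
    by (subst analytic_on_analytic_at) (auto intro!: appell_abs_summable(2) assms)
  then show ?thesis
    using analytic_on_compose[OF assms(2)] by (simp add: o_def)
qed

text \<open>Only the term n = 0 is singular at 1, and its numerator is \<beta>. The other terms form
  a partial fraction sum that is analytic at 1, since p^n = 1 forces n = 0.\<close>

lemma appell_pole:
  assumes "norm \<sigma> = 1"
  shows "((\<lambda>z. (1 - z) * appell \<sigma> b \<alpha> \<beta> z) \<longlongrightarrow> of_int \<beta>) (at 1)"
proof -
  define R where "R = (\<lambda>z. \<Sum>\<^sub>\<infinity>n\<in>-{0}. coeff \<sigma> b \<alpha> \<beta> n / (1 - z * (Q ^ 6) powi n))"
  obtain \<delta> where \<delta>: "\<delta> > 0" "\<And>n::int. 1 * (Q ^ 6) powi n \<noteq> 1 \<Longrightarrow>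
      \<delta> * (1 + norm ((Q ^ 6) powi n)) \<le> norm (1 - 1 * (Q ^ 6) powi n)"
    using power_int_gap[of 1] by auto
  have ne: "1 * (Q ^ 6) powi n \<noteq> 1" if "n \<in> -{0}" for n :: int
  proof
    assume "1 * (Q ^ 6) powi n = 1"
    then have "norm (Q ^ 6) powi n = 1"
      by (metis mult_1 norm_one norm_power_int)
    then show False
      using that norm_power_int_eq_1 by auto
  qed
  have "R analytic_on {1}"
    unfolding R_def using \<delta> ne
    by (intro partial_fraction_sum_analytic[where \<delta> = \<delta>]
        summable_on_subset_banach[OF coeff_abs_summable[OF assms]]) auto
  then have "(R \<longlongrightarrow> R 1) (at 1)"
    using analytic_at_imp_isCont isContD by blast
  then have "((\<lambda>z. of_int \<beta> + (1 - z) * R z) \<longlongrightarrow> of_int \<beta> + (1 - 1) * R 1) (at 1)"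
    by (intro tendsto_intros)
  moreover have "\<forall>\<^sub>F z in at 1. theta (Q ^ 6) (z / 1) \<noteq> 0"
    by (intro eventually_theta_nz) auto
  then have "\<forall>\<^sub>F z in at 1. of_int \<beta> + (1 - z) * R z = (1 - z) * appell \<sigma> b \<alpha> \<beta> z"
    using eventually_neq_at_within[of 1 1] eventually_neq_at_within[of 0 1]
  proof eventually_elim
    case (elim z)
    then have hs: "((\<lambda>n. coeff \<sigma> b \<alpha> \<beta> n / (1 - z * (Q ^ 6) powi n)) has_sum appell \<sigma> b \<alpha> \<beta> z) UNIV"
      by (intro appell_has_sum assms) auto
    then have "(\<lambda>n. coeff \<sigma> b \<alpha> \<beta> n / (1 - z * (Q ^ 6) powi n)) summable_on -{0}"
      using has_sum_imp_summable summable_on_subset_banach by blast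
    then have "infsum (\<lambda>n. coeff \<sigma> b \<alpha> \<beta> n / (1 - z * (Q ^ 6) powi n)) (insert 0 (- {0}))
        = of_int \<beta> / (1 - z) + R z"
      unfolding R_def by (subst infsum_insert) (auto simp: coeff_def)
    moreover have "insert 0 (- {0}) = (UNIV :: int set)"
      by auto
    ultimately have "appell \<sigma> b \<alpha> \<beta> z = of_int \<beta> / (1 - z) + R z"
      by (simp add: appell_def)
    then show ?case
      using elim by (simp add: field_simps)
  qed
  ultimately show ?thesis
    using Lim_transform_eventually by fastforce
qed

text \<open>Replacing n by n - 1 gives terms with u^(-1) / (1 - z u), where u = Q^(6 n), and u^(-1)
  / (1 - z u) = z / (1 - z u) + u^(-1). The first part is the sum at z again, the second is free of
  z and adds up to C. The weight drops by \<alpha>, the exponent contributes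
  \<open>Q powi (3 - b)\<close>, and \<sigma>^2 = 1 makes the shifted sign equal to \<sigma> times
  the old one.\<close>

lemma appell_shift:
  assumes "\<sigma> * \<sigma> = 1"
  obtains C where "\<And>z. z \<noteq> 0 \<Longrightarrow> theta (Q ^ 6) z \<noteq> 0 \<Longrightarrow>
    appell \<sigma> b \<alpha> \<beta> (Q ^ 6 * z) = \<sigma> * Q powi (3 - b) * z * appell \<sigma> b \<alpha> (\<beta> - \<alpha>) z + C"
proof -
  define \<kappa> where "\<kappa> = \<sigma> * Q powi (3 - b)"
  have \<sigma>: "norm \<sigma> = 1" "\<sigma> \<noteq> 0"
    using assms by (auto simp: square_eq_1_iff)
  define C where "C = \<kappa> * (\<Sum>\<^sub>\<infinity>n. coeff \<sigma> (b - 6) \<alpha> (\<beta> - \<alpha>) n)"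
  have "appell \<sigma> b \<alpha> \<beta> (Q ^ 6 * z) = \<kappa> * z * appell \<sigma> b \<alpha> (\<beta> - \<alpha>) z + C"
    if z: "z \<noteq> 0" "theta (Q ^ 6) z \<noteq> 0" for z
  proof -
    have "((\<lambda>n. \<kappa> * z * (coeff \<sigma> b \<alpha> (\<beta> - \<alpha>) n / (1 - z * (Q ^ 6) powi n))
          + \<kappa> * coeff \<sigma> (b - 6) \<alpha> (\<beta> - \<alpha>) n)
        has_sum (\<kappa> * z * appell \<sigma> b \<alpha> (\<beta> - \<alpha>) z + C)) UNIV"
      unfolding C_def using z \<sigma>
      by (intro has_sum_add has_sum_cmult_right has_sum_infsum appell_has_sum
          abs_summable_summable[OF coeff_abs_summable])
    moreover have "\<kappa> * z * (coeff \<sigma> b \<alpha> (\<beta> - \<alpha>) n / (1 - z * (Q ^ 6) powi n))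
          + \<kappa> * coeff \<sigma> (b - 6) \<alpha> (\<beta> - \<alpha>) n
        = coeff \<sigma> b \<alpha> \<beta> (n - 1) / (1 - Q ^ 6 * z * (Q ^ 6) powi (n - 1))" for n :: int
    proof -
      have pn: "(Q ^ 6) powi n = Q powi (6 * n)"
        using Q_nz by (simp add: power_int_mult)
      have "z * Q powi (6 * n) \<noteq> 1"
      proof
        assume "z * Q powi (6 * n) = 1"
        then have "z = (Q ^ 6) powi (- n)"
          using Q_nz pn by (simp add: power_int_minus field_simps)
        then show False
          using z theta_eq_0_iff by blast
      qed
      then have d: "1 - z * Q powi (6 * n) \<noteq> 0" by simp
      have "Q ^ 6 * z * (Q ^ 6) powi (n - 1) = z * Q powi (6 * n)"
        using Q_nz by (simp add: power_int_diff pn)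
      moreover have "\<sigma> powi (n - 1) = \<sigma> * \<sigma> powi n"
        using \<sigma> assms by (simp add: power_int_diff field_simps)
      then have "coeff \<sigma> b \<alpha> \<beta> (n - 1) = of_int (\<alpha> * n + (\<beta> - \<alpha>)) * \<sigma> powi n * \<kappa>
          * Q powi (3 * n * n + b * n - 6 * n)"
      proof -
        have e: "3 * (n - 1) * (n - 1) + b * (n - 1) = (3 - b) + (3 * n * n + b * n - 6 * n)"
          by (simp add: algebra_simps)
        have "Q powi (3 * (n - 1) * (n - 1) + b * (n - 1))
            = Q powi (3 - b) * Q powi (3 * n * n + b * n - 6 * n)"
          unfolding e using Q_nz by (intro power_int_add) auto
        moreover have "\<alpha> * (n - 1) + \<beta> = \<alpha> * n + (\<beta> - \<alpha>)"
          by (simp add: algebra_simps)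
        ultimately show ?thesis
          unfolding coeff_def \<kappa>_def using \<open>\<sigma> powi (n - 1) = \<sigma> * \<sigma> powi n\<close> by (simp only: mult_ac)
      qed
      moreover have "coeff \<sigma> (b - 6) \<alpha> (\<beta> - \<alpha>) n = of_int (\<alpha> * n + (\<beta> - \<alpha>)) * \<sigma> powi n
          * Q powi (3 * n * n + b * n - 6 * n)"
        by (simp add: coeff_def algebra_simps)
      moreover have "coeff \<sigma> b \<alpha> (\<beta> - \<alpha>) n = of_int (\<alpha> * n + (\<beta> - \<alpha>)) * \<sigma> powi n
          * (Q powi (3 * n * n + b * n - 6 * n) * Q powi (6 * n))"
        using Q_nz by (simp add: coeff_def flip: power_int_add)
      ultimately show ?thesis
        unfolding pn using d by (simp add: field_simps del: of_int_add of_int_diff of_int_mult)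
    qed
    ultimately have "((\<lambda>n. coeff \<sigma> b \<alpha> \<beta> (n - 1) / (1 - Q ^ 6 * z * (Q ^ 6) powi (n - 1)))
        has_sum (\<kappa> * z * appell \<sigma> b \<alpha> (\<beta> - \<alpha>) z + C)) UNIV"
      by (simp only:)
    then have "((\<lambda>n. coeff \<sigma> b \<alpha> \<beta> n / (1 - Q ^ 6 * z * (Q ^ 6) powi n))
        has_sum (\<kappa> * z * appell \<sigma> b \<alpha> (\<beta> - \<alpha>) z + C)) UNIV"
      by (subst (asm) has_sum_reindex_bij_witness[where i = "\<lambda>n. n + 1" and j = "\<lambda>n. n - 1"
            and h = "\<lambda>n. coeff \<sigma> b \<alpha> \<beta> n / (1 - Q ^ 6 * z * (Q ^ 6) powi n)" and T = UNIV]) auto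
    then show ?thesis
      unfolding appell_def by (rule infsumI)
  qed
  then show ?thesis
    using that unfolding \<kappa>_def by blast
qed

text \<open>Applied with \<gamma> = -6 to undo the drop of the weight caused by a shift, and with
  \<gamma> = j to separate the coefficient of j in the theorem.\<close>

lemma appell_weight:
  assumes "norm \<sigma> = 1" "z \<noteq> 0" "theta (Q ^ 6) z \<noteq> 0"
  shows "appell \<sigma> b \<alpha> (\<beta> + \<gamma>) z = appell \<sigma> b \<alpha> \<beta> z + of_int \<gamma> * appell \<sigma> b 0 1 z"
proof -
  have "((\<lambda>n. coeff \<sigma> b \<alpha> \<beta> n / (1 - z * (Q ^ 6) powi n)
        + of_int \<gamma> * (coeff \<sigma> b 0 1 n / (1 - z * (Q ^ 6) powi n)))
      has_sum (appell \<sigma> b \<alpha> \<beta> z + of_int \<gamma> * appell \<sigma> b 0 1 z)) UNIV"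
    by (intro has_sum_add has_sum_cmult_right appell_has_sum assms)
  moreover have "coeff \<sigma> b \<alpha> \<beta> n / (1 - z * (Q ^ 6) powi n)
        + of_int \<gamma> * (coeff \<sigma> b 0 1 n / (1 - z * (Q ^ 6) powi n))
      = coeff \<sigma> b \<alpha> (\<beta> + \<gamma>) n / (1 - z * (Q ^ 6) powi n)" for n
    by (simp add: coeff_def add_divide_distrib algebra_simps)
  ultimately show ?thesis
    unfolding appell_def[of _ _ _ "\<beta> + \<gamma>"] by (simp only: infsumI)
qed

end

section \<open>The two identities\<close>

lemma tendsto_rescale:
  fixes F :: "complex \<Rightarrow> complex"
  assumes "((\<lambda>z. (1 - z) * F z) \<longlongrightarrow> L) (at 1)" "a \<noteq> 0"
  shows "((\<lambda>x. (1 - x / a) * F (x / a)) \<longlongrightarrow> L) (at a)"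
proof (rule filterlim_compose[OF assms(1)])
  show "filterlim (\<lambda>x. x / a) (at 1) (at a)"
    unfolding filterlim_at
    using assms(2) eventually_neq_at_within[of a a]
    by (auto intro!: tendsto_eq_intros simp: eventually_at_filter)
qed

lemma tendsto_zero_of_analytic:
  fixes F :: "complex \<Rightarrow> complex"
  assumes "F analytic_on {a}" "a \<noteq> 0"
  shows "((\<lambda>x. (1 - x / a) * F x) \<longlongrightarrow> 0) (at a)"
proof -
  have "(F \<longlongrightarrow> F a) (at a)"
    using assms analytic_at_imp_isCont isContD by blast
  then have "((\<lambda>x. (1 - x / a) * F x) \<longlongrightarrow> (1 - a / a) * F a) (at a)"
    using assms by (intro tendsto_intros) auto
  then show ?thesis
    using assms by simp
qed

lemma tendsto_at_analytic:
  fixes F :: "complex \<Rightarrow> complex"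
  assumes "F analytic_on {a}" "F a = L"
  shows "(F \<longlongrightarrow> L) (at a)"
  using assms analytic_at_imp_isCont isContD by blast

lemma (in nome) theta_pole: "((\<lambda>z. (1 - z) * (1 / theta p z)) \<longlongrightarrow> 1 / (qpoch p p)\<^sup>2) (at 1)"
proof -
  have "(\<lambda>z. 1 / (qpoch (p * z) p * qpoch (p / z) p)) analytic_on {1}"
    using qpoch_p_nz by (auto intro!: analytic_intros simp: norm_p)
  then have "((\<lambda>z. 1 / (qpoch (p * z) p * qpoch (p / z) p)) \<longlongrightarrow> 1 / (qpoch p p)\<^sup>2) (at 1)"
    by (rule tendsto_at_analytic) (simp add: power2_eq_square)
  moreover have "\<forall>\<^sub>F z in at 1. 1 / (qpoch (p * z) p * qpoch (p / z) p) = (1 - z) * (1 / theta p z)"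
    using eventually_neq_at_within[of 1 1]
    by eventually_elim (simp add: theta_factor)
  ultimately show ?thesis
    by (rule Lim_transform_eventually)
qed

lemma (in nome) theta_1 [simp]: "theta p 1 = 0"
  by (simp add: theta_factor)

context appell_sums
begin

abbreviation \<theta> :: "complex \<Rightarrow> complex" where "\<theta> \<equiv> theta (Q ^ 6)"

lemma \<theta>_nz: "k \<in> {1..5} \<Longrightarrow> \<theta> (Q ^ k) \<noteq> 0" "k \<in> {1..5} \<Longrightarrow> \<theta> (- (Q ^ k)) \<noteq> 0"
proof -
  have "norm Q ^ 6 < norm Q ^ k \<and> norm Q ^ k < 1" if "k \<in> {1..5}" for k
    using that Q_nz norm_Q by (auto intro!: power_strict_decreasing power_less_one_iff[THEN iffD2])
  then show "k \<in> {1..5} \<Longrightarrow> \<theta> (Q ^ k) \<noteq> 0" "k \<in> {1..5} \<Longrightarrow> \<theta> (- (Q ^ k)) \<noteq> 0"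
    using theta_nz_of_norm[of "Q ^ k"] theta_nz_of_norm[of "- (Q ^ k)"] by (auto simp: norm_power)
qed

lemma \<theta>_inverse:
  "\<theta> (1 / Q ^ k) = - \<theta> (Q ^ k) / Q ^ k" "\<theta> (- 1 / Q ^ k) = \<theta> (- (Q ^ k)) / Q ^ k"
  "\<theta> (- (1 / Q ^ k)) = \<theta> (- (Q ^ k)) / Q ^ k"
  using theta_inverse[of "Q ^ k"] theta_inverse[of "- (Q ^ k)"] Q_nz by auto

lemma \<theta>_Q4: "\<theta> (Q ^ 4) = \<theta> (Q ^ 2)" "\<theta> (- (Q ^ 4)) = \<theta> (- (Q ^ 2))"
proof -
  have "Q ^ 6 / Q ^ 2 = Q ^ 4"
    using Q_nz by (simp add: power_diff flip: power_diff)
  then show "\<theta> (Q ^ 4) = \<theta> (Q ^ 2)" "\<theta> (- (Q ^ 4)) = \<theta> (- (Q ^ 2))"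
    using theta_reflect[of "Q ^ 2"] theta_reflect[of "- (Q ^ 2)"] by auto
qed

lemma zeta_sum_Q4: "zeta_sum (- (Q ^ 4)) = - zeta_sum (- (Q ^ 2))"
proof -
  have "Q ^ 6 / - (Q ^ 2) = - (Q ^ 4)"
    using Q_nz by (simp add: power_diff flip: power_diff)
  then show ?thesis
    using zeta_sum_reflect[of "- (Q ^ 2)"] by simp
qed

text \<open>Since -1 is its own inverse, \<open>zeta_sum_inverse\<close> becomes a linear equation
  for this value.\<close>

lemma zeta_sum_minus_1: "zeta_sum (- 1) = - 1 / 2"
  using zeta_sum_inverse[of "- 1"] by (simp add: field_simps eq_neg_iff_add_eq_0)

section \<open>The theta quotient in front of the braces, and identity A\<close>

definition prefactor :: "complex \<Rightarrow> complex" where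
  "prefactor x = \<theta> (x * Q ^ 2) * \<theta> (Q ^ 4) * (qpoch (Q ^ 6) (Q ^ 6))\<^sup>2
     / (\<theta> (- x) * \<theta> (- (Q ^ 2)) * \<theta> (- (x * Q ^ 4)))"

lemma prefactor_shift:
  assumes "x \<noteq> 0"
  shows "prefactor (Q ^ 6 * x) = - (Q ^ 2) * x * prefactor x"
proof -
  have "\<theta> (Q ^ 6 * (x * Q ^ 2)) = - \<theta> (x * Q ^ 2) / (x * Q ^ 2)"
    "\<theta> (Q ^ 6 * (- x)) = \<theta> (- x) / x"
    "\<theta> (Q ^ 6 * (- (x * Q ^ 4))) = \<theta> (- (x * Q ^ 4)) / (x * Q ^ 4)"
    using theta_shift[of "x * Q ^ 2"] theta_shift[of "- x"] theta_shift[of "- (x * Q ^ 4)"] assms Q_nz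
    by auto
  moreover have "Q ^ 6 * x * Q ^ 2 = Q ^ 6 * (x * Q ^ 2)" "- (Q ^ 6 * x) = Q ^ 6 * (- x)"
    "- (Q ^ 6 * x * Q ^ 4) = Q ^ 6 * (- (x * Q ^ 4))"
    by simp_all
  ultimately have "prefactor (Q ^ 6 * x) = (- \<theta> (x * Q ^ 2) / (x * Q ^ 2)) * \<theta> (Q ^ 4) * (qpoch (Q ^ 6) (Q ^ 6))\<^sup>2
     / (\<theta> (- x) / x * \<theta> (- (Q ^ 2)) * (\<theta> (- (x * Q ^ 4)) / (x * Q ^ 4)))"
    unfolding prefactor_def by (simp only:)
  also have "\<dots> = - (Q ^ 2) * x * prefactor x"
    using assms Q_nz unfolding prefactor_def by (simp add: divide_simps power2_eq_square power4_eq_xxxx)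
  finally show ?thesis .
qed

lemma prefactor_analytic:
  assumes "x \<noteq> 0" "\<theta> (- x) \<noteq> 0" "\<theta> (- (x * Q ^ 4)) \<noteq> 0"
  shows "prefactor analytic_on {x}"
  unfolding prefactor_def[abs_def] using assms Q_nz \<theta>_nz
  by (auto intro!: analytic_intros)

text \<open>At -1 the remaining theta values in numerator and denominator are the same, which leaves
  the square of \<open>qpoch (Q ^ 6) (Q ^ 6)\<close>. \<open>theta_pole\<close> supplies its
  reciprocal.\<close>

lemma prefactor_pole_minus_1: "((\<lambda>x. (1 - x / (- 1)) * prefactor x) \<longlongrightarrow> 1) (at (- 1))"
proof -
  have "(\<lambda>x. \<theta> (x * Q ^ 2) * \<theta> (Q ^ 4) * (qpoch (Q ^ 6) (Q ^ 6))\<^sup>2 / (\<theta> (- (Q ^ 2)) * \<theta> (- (x * Q ^ 4))))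
      analytic_on {- 1}"
    using Q_nz \<theta>_nz by (auto intro!: analytic_intros)
  then have "((\<lambda>x. \<theta> (x * Q ^ 2) * \<theta> (Q ^ 4) * (qpoch (Q ^ 6) (Q ^ 6))\<^sup>2 / (\<theta> (- (Q ^ 2)) * \<theta> (- (x * Q ^ 4))))
      \<longlongrightarrow> (qpoch (Q ^ 6) (Q ^ 6))\<^sup>2) (at (- 1))"
    by (rule tendsto_at_analytic) (use \<theta>_nz in auto)
  moreover have "((\<lambda>x. (1 - x / (- 1)) * (1 / \<theta> (x / (- 1)))) \<longlongrightarrow> 1 / (qpoch (Q ^ 6) (Q ^ 6))\<^sup>2) (at (- 1))"
    by (rule tendsto_rescale[OF theta_pole]) simp
  ultimately have "((\<lambda>x. (1 - x / (- 1)) * (1 / \<theta> (x / (- 1))) * (\<theta> (x * Q ^ 2) * \<theta> (Q ^ 4) * (qpoch (Q ^ 6) (Q ^ 6))\<^sup>2 / (\<theta> (- (Q ^ 2)) * \<theta> (- (x * Q ^ 4)))))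
      \<longlongrightarrow> 1 / (qpoch (Q ^ 6) (Q ^ 6))\<^sup>2 * (qpoch (Q ^ 6) (Q ^ 6))\<^sup>2) (at (- 1))"
    by (intro tendsto_mult)
  then show ?thesis
    using qpoch_p_nz by (simp add: prefactor_def mult_ac)
qed

text \<open>Here the theta values agree only up to inversion: the factor 1 / Q^2 from -1 / Q^2 and
  the factor - 1 / Q^4 from 1 / Q^4 combine to - Q^2.\<close>

lemma prefactor_pole_minus_Q4:
  "((\<lambda>x. (1 - x / (- 1 / Q ^ 4)) * prefactor x) \<longlongrightarrow> - (Q ^ 2)) (at (- 1 / Q ^ 4))"
proof -
  have "(\<lambda>x. \<theta> (x * Q ^ 2) * \<theta> (Q ^ 4) * (qpoch (Q ^ 6) (Q ^ 6))\<^sup>2 / (\<theta> (- x) * \<theta> (- (Q ^ 2))))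
      analytic_on {- 1 / Q ^ 4}"
    using Q_nz \<theta>_nz by (auto intro!: analytic_intros simp: \<theta>_inverse)
  moreover have "- 1 / Q ^ 4 * Q ^ 2 = - 1 / Q ^ 2" "- (- 1 / Q ^ 4) = 1 / Q ^ 4"
    using Q_nz by (simp_all add: field_simps flip: power_add)
  then have "\<theta> (- 1 / Q ^ 4 * Q ^ 2) * \<theta> (Q ^ 4) * (qpoch (Q ^ 6) (Q ^ 6))\<^sup>2
      / (\<theta> (- (- 1 / Q ^ 4)) * \<theta> (- (Q ^ 2))) = - (Q ^ 2) * (qpoch (Q ^ 6) (Q ^ 6))\<^sup>2"
    using Q_nz \<theta>_nz by (simp only: \<theta>_inverse) (simp add: field_simps flip: power_add)
  ultimately have "((\<lambda>x. \<theta> (x * Q ^ 2) * \<theta> (Q ^ 4) * (qpoch (Q ^ 6) (Q ^ 6))\<^sup>2 / (\<theta> (- x) * \<theta> (- (Q ^ 2))))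
      \<longlongrightarrow> - (Q ^ 2) * (qpoch (Q ^ 6) (Q ^ 6))\<^sup>2) (at (- 1 / Q ^ 4))"
    by (rule tendsto_at_analytic)
  moreover have "((\<lambda>x. (1 - x / (- 1 / Q ^ 4)) * (1 / \<theta> (x / (- 1 / Q ^ 4)))) \<longlongrightarrow> 1 / (qpoch (Q ^ 6) (Q ^ 6))\<^sup>2) (at (- 1 / Q ^ 4))"
    by (rule tendsto_rescale[OF theta_pole]) (use Q_nz in simp)
  ultimately have "((\<lambda>x. (1 - x / (- 1 / Q ^ 4)) * (1 / \<theta> (x / (- 1 / Q ^ 4))) * (\<theta> (x * Q ^ 2) * \<theta> (Q ^ 4) * (qpoch (Q ^ 6) (Q ^ 6))\<^sup>2 / (\<theta> (- x) * \<theta> (- (Q ^ 2)))))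
      \<longlongrightarrow> 1 / (qpoch (Q ^ 6) (Q ^ 6))\<^sup>2 * (- (Q ^ 2) * (qpoch (Q ^ 6) (Q ^ 6))\<^sup>2)) (at (- 1 / Q ^ 4))"
    by (intro tendsto_mult)
  then show ?thesis
    using qpoch_p_nz by (simp add: prefactor_def mult_ac)
qed

text \<open>Identity A, the coefficient of j. Both Appell sums have the multiplier - Q^2 x of
  \<open>prefactor_shift\<close>, and by \<open>appell_pole\<close> their contributions 1 at -1 and
  - Q^2 at -1 / Q^4 are those of the prefactor.\<close>

lemma appell_identity:
  assumes "x \<noteq> 0" "\<theta> (- x) \<noteq> 0" "\<theta> (- (x * Q ^ 4)) \<noteq> 0"
  shows "prefactor x = appell 1 1 0 1 (- x) - Q ^ 2 * appell 1 5 0 1 (- (x * Q ^ 4))"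
proof -
  define A where "A = {- 1, - 1 / Q ^ 4}"
  define f where "f = (\<lambda>x. prefactor x - appell 1 1 0 1 (- x) + Q ^ 2 * appell 1 5 0 1 (- (x * Q ^ 4)))"
  define R where "R = {x. x \<noteq> 0 \<and> (\<forall>a\<in>A. \<theta> (x / a) \<noteq> 0)}"
  have R: "R = {x. x \<noteq> 0 \<and> \<theta> (- x) \<noteq> 0 \<and> \<theta> (- (x * Q ^ 4)) \<noteq> 0}"
    using Q_nz by (auto simp: R_def A_def)
  obtain C1 where C1: "\<And>z. z \<noteq> 0 \<Longrightarrow> \<theta> z \<noteq> 0 \<Longrightarrow>
    appell 1 1 0 1 (Q ^ 6 * z) = 1 * Q powi (3 - 1) * z * appell 1 1 0 (1 - 0) z + C1"
    using appell_shift[of 1 1 0 1] by auto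
  obtain C2 where C2: "\<And>z. z \<noteq> 0 \<Longrightarrow> \<theta> z \<noteq> 0 \<Longrightarrow>
    appell 1 5 0 1 (Q ^ 6 * z) = 1 * Q powi (3 - 5) * z * appell 1 5 0 (1 - 0) z + C2"
    using appell_shift[of 1 5 0 1] by auto
  \<comment> \<open>The second sum brings the factor Q^(3 - 5), and its argument brings Q^4;
    together they give the same Q^2 as the first sum.\<close>
  have Qm2: "Q powi (- 2) * Q ^ 4 = Q ^ 2"
    using Q_nz by (simp add: power_int_minus field_simps flip: power_add)
  have "f x = 0"
  proof (rule q_difference_Liouville[where A = A and f = f and x = x and k = "- (Q ^ 2)" and C = "Q ^ 2 * C2 - C1", folded R_def])
    show "f analytic_on R"
    proof (subst analytic_on_analytic_at, intro ballI)
      fix x assume "x \<in> R"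
      then show "f analytic_on {x}"
        unfolding R f_def using Q_nz by (auto intro!: analytic_intros prefactor_analytic)
    qed
    show "f (Q ^ 6 * x) = - (Q ^ 2) * x * f x + (Q ^ 2 * C2 - C1)" if "x \<in> R" for x
    proof -
      have "appell 1 1 0 1 (- (Q ^ 6 * x)) = Q ^ 2 * (- x) * appell 1 1 0 1 (- x) + C1"
        using that C1[of "- x"] by (simp add: R)
      moreover have "appell 1 5 0 1 (- (Q ^ 6 * x * Q ^ 4)) = - (x * Q ^ 2) * appell 1 5 0 1 (- (x * Q ^ 4)) + C2"
      proof -
        have "appell 1 5 0 1 (Q ^ 6 * (- (x * Q ^ 4))) = Q powi (- 2) * (- (x * Q ^ 4)) * appell 1 5 0 1 (- (x * Q ^ 4)) + C2"
          using that C2[of "- (x * Q ^ 4)"] Q_nz by (simp add: R)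
        also have "Q powi (- 2) * (- (x * Q ^ 4)) = - (x * Q ^ 2)"
          using Qm2 by (simp add: mult_ac)
        finally show ?thesis by (simp add: mult_ac)
      qed
      moreover have "prefactor (Q ^ 6 * x) = - (Q ^ 2) * x * prefactor x"
        using that by (intro prefactor_shift) (simp add: R)
      ultimately show ?thesis
        unfolding f_def by (simp only:) (simp add: algebra_simps)
    qed
    show "((\<lambda>x. (1 - x / a) * f x) \<longlongrightarrow> 0) (at a)" if "a \<in> A" for a
    proof -
      consider "a = - 1" | "a = - 1 / Q ^ 4"
        using \<open>a \<in> A\<close> unfolding A_def by blast
      then show ?thesis
      proof cases
        case 1
        have "((\<lambda>x. (1 - x / a) * appell 1 1 0 1 (x / a)) \<longlongrightarrow> of_int 1) (at a)"
          unfolding 1 by (intro tendsto_rescale appell_pole) auto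
        moreover have "((\<lambda>x. (1 - x / a) * appell 1 5 0 1 (- (x * Q ^ 4))) \<longlongrightarrow> 0) (at a)"
          unfolding 1 using Q_nz \<theta>_nz by (intro tendsto_zero_of_analytic) (auto intro!: analytic_intros)
        ultimately have "((\<lambda>x. (1 - x / a) * prefactor x - (1 - x / a) * appell 1 1 0 1 (x / a)
            + Q ^ 2 * ((1 - x / a) * appell 1 5 0 1 (- (x * Q ^ 4)))) \<longlongrightarrow> 1 - of_int 1 + Q ^ 2 * 0) (at a)"
          using prefactor_pole_minus_1 unfolding 1 by (intro tendsto_intros)
        then show ?thesis
          by (simp add: 1 f_def algebra_simps)
      next
        case 2
        have "((\<lambda>x. (1 - x / a) * appell 1 5 0 1 (x / a)) \<longlongrightarrow> of_int 1) (at a)"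
          unfolding 2 using Q_nz by (intro tendsto_rescale appell_pole) auto
        moreover have "((\<lambda>x. (1 - x / a) * appell 1 1 0 1 (- x)) \<longlongrightarrow> 0) (at a)"
          unfolding 2 using Q_nz \<theta>_nz
          by (intro tendsto_zero_of_analytic) (auto intro!: analytic_intros simp: \<theta>_inverse)
        ultimately have "((\<lambda>x. (1 - x / a) * prefactor x - (1 - x / a) * appell 1 1 0 1 (- x)
            + Q ^ 2 * ((1 - x / a) * appell 1 5 0 1 (x / a))) \<longlongrightarrow> - (Q ^ 2) - 0 + Q ^ 2 * of_int 1) (at a)"
          using prefactor_pole_minus_Q4 unfolding 2 by (intro tendsto_intros)
        then show ?thesis
          using Q_nz by (simp add: 2 f_def algebra_simps)
      qed
    qed
    show "x \<in> R"
      using assms by (simp add: R)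
  qed (use Q_nz in \<open>auto simp: A_def\<close>)
  then show ?thesis
    by (simp add: f_def algebra_simps)
qed


text \<open>The series inside the braces, see \<open>Lambda_suminf\<close>. The coefficients 2 + 4
  add up to the 6 of the weights 6 n + const. The constant term makes the value at -1 equal to 0 and
  the value at -1 / Q^4 equal to 4, which are the constant parts of the two weights.\<close>

definition Lambda :: "complex \<Rightarrow> complex" where
  "Lambda x = - 2 * zeta_sum (- (Q ^ 2)) - 2 * zeta_sum (x * Q ^ 2) - 4 * zeta_sum (x * Q ^ 4)"

lemma Lambda_shift:
  assumes "x \<noteq> 0" "\<theta> (x * Q ^ 2) \<noteq> 0" "\<theta> (x * Q ^ 4) \<noteq> 0"
  shows "Lambda (Q ^ 6 * x) = Lambda x - 6"
proof -
  have "x * Q ^ 2 \<noteq> 1" "x * Q ^ 4 \<noteq> 1"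
    using assms theta_1 by metis+
  then have "zeta_sum (Q ^ 6 * (x * Q ^ 2)) = zeta_sum (x * Q ^ 2) + 1"
    "zeta_sum (Q ^ 6 * (x * Q ^ 4)) = zeta_sum (x * Q ^ 4) + 1"
    using assms Q_nz by (auto intro!: zeta_sum_shift)
  then show ?thesis
    by (simp add: Lambda_def mult.assoc)
qed

lemma Lambda_analytic:
  assumes "x \<noteq> 0" "\<theta> (x * Q ^ 2) \<noteq> 0" "\<theta> (x * Q ^ 4) \<noteq> 0"
  shows "Lambda analytic_on {x}"
  unfolding Lambda_def[abs_def] using assms Q_nz by (auto intro!: analytic_intros)

definition theta_quot :: complex where
  "theta_quot = 2 * (qpoch (Q ^ 2) (Q ^ 2))\<^sup>2 / (qpoch (- (Q ^ 2)) (Q ^ 2))\<^sup>2"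

text \<open>This is the condition for the pole at 1 / Q^4 to cancel: \<open>Lambda\<close>
  contributes -4 there, the last series contributes its coefficient. Trisection turns the base Q^2
  into theta values at Q^2 and - Q^2, and the factor 2 in theta(-1) accounts for the 2 in
  \<open>theta_quot\<close>.\<close>

lemma theta_quot_residue: "4 * prefactor (1 / Q ^ 4) = - theta_quot * Q ^ 2"
proof -
  have w: "norm (Q ^ 2) < 1" "(Q ^ 2) ^ 3 = Q ^ 6"
    using norm_Q by (auto simp: norm_power power_less_one_iff simp flip: power_mult)
  have pw: "Q ^ 6 / Q ^ 2 = Q ^ 4" "Q ^ 6 / - (Q ^ 2) = - (Q ^ 4)"
    using Q_nz by (simp_all add: power_diff flip: power_diff)
  have 1: "qpoch (Q ^ 2) (Q ^ 2) = \<theta> (Q ^ 2) * qpoch (Q ^ 6) (Q ^ 6)"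
    unfolding qpoch_trisection[OF w(1), of "Q ^ 2"] w theta_def pw by (simp flip: power_add)
  have 2: "qpoch (- (Q ^ 2)) (Q ^ 2) = \<theta> (- (Q ^ 2)) * qpoch (- (Q ^ 6)) (Q ^ 6)"
    unfolding qpoch_trisection[OF w(1), of "- (Q ^ 2)"] w theta_def pw by (simp flip: power_add)
  have 3: "\<theta> (- 1) = 2 * (qpoch (- (Q ^ 6)) (Q ^ 6))\<^sup>2"
    by (simp add: theta_factor power2_eq_square)
  then have 4: "qpoch (- (Q ^ 6)) (Q ^ 6) \<noteq> 0"
    using theta_minus_1_nz by auto
  have "1 / Q ^ 4 * Q ^ 2 = 1 / Q ^ 2" "1 / Q ^ 4 * Q ^ 4 = 1"
    using Q_nz by (simp_all add: field_simps flip: power_add)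
  then have 5: "prefactor (1 / Q ^ 4) = (- \<theta> (Q ^ 2) / Q ^ 2) * \<theta> (Q ^ 2) * (qpoch (Q ^ 6) (Q ^ 6))\<^sup>2
      / (\<theta> (- (Q ^ 2)) / Q ^ 4 * \<theta> (- (Q ^ 2)) * (2 * (qpoch (- (Q ^ 6)) (Q ^ 6))\<^sup>2))"
    unfolding prefactor_def by (simp only: \<theta>_inverse \<theta>_Q4 3)
  show ?thesis
    unfolding theta_quot_def 1 2 5 using Q_nz \<theta>_nz(2)[of 2] 4
    by (simp add: field_simps power2_eq_square power4_eq_xxxx)
qed

text \<open>Identity B. At -1 and -1 / Q^4 the pole of the prefactor is weighted by the value of
  \<open>Lambda\<close> and meets the weighted sums. At 1 / Q^4 and 1 / Q^2 it is
  \<open>Lambda\<close> that has the pole: the former is matched by the last series, the latter by a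
  zero of the prefactor.\<close>

lemma weighted_appell_identity:
  assumes "x \<noteq> 0" "\<theta> (- x) \<noteq> 0" "\<theta> (- (x * Q ^ 4)) \<noteq> 0"
    "\<theta> (x * Q ^ 4) \<noteq> 0" "\<theta> (x * Q ^ 2) \<noteq> 0"
  shows "prefactor x * Lambda x = appell 1 1 6 0 (- x) - Q ^ 2 * appell 1 5 6 4 (- (x * Q ^ 4))
    + theta_quot * Q ^ 2 * appell (- 1) 5 0 1 (x * Q ^ 4)"
proof -
  define A where "A = {- 1, - 1 / Q ^ 4, 1 / Q ^ 4, 1 / Q ^ 2}"
  define f where "f = (\<lambda>x. prefactor x * Lambda x - appell 1 1 6 0 (- x)
    + Q ^ 2 * appell 1 5 6 4 (- (x * Q ^ 4)) - theta_quot * Q ^ 2 * appell (- 1) 5 0 1 (x * Q ^ 4))"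
  define R where "R = {x. x \<noteq> 0 \<and> (\<forall>a\<in>A. \<theta> (x / a) \<noteq> 0)}"
  have R: "R = {x. x \<noteq> 0 \<and> \<theta> (- x) \<noteq> 0 \<and> \<theta> (- (x * Q ^ 4)) \<noteq> 0
      \<and> \<theta> (x * Q ^ 4) \<noteq> 0 \<and> \<theta> (x * Q ^ 2) \<noteq> 0}"
    using Q_nz by (auto simp: R_def A_def)
  obtain C1 where C1: "\<And>z. z \<noteq> 0 \<Longrightarrow> \<theta> z \<noteq> 0 \<Longrightarrow>
    appell 1 1 6 0 (Q ^ 6 * z) = 1 * Q powi (3 - 1) * z * appell 1 1 6 (0 - 6) z + C1"
    using appell_shift[of 1 1 6 0] by auto
  obtain C2 where C2: "\<And>z. z \<noteq> 0 \<Longrightarrow> \<theta> z \<noteq> 0 \<Longrightarrow>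
    appell 1 5 6 4 (Q ^ 6 * z) = 1 * Q powi (3 - 5) * z * appell 1 5 6 (4 - 6) z + C2"
    using appell_shift[of 1 5 6 4] by auto
  obtain C3 where C3: "\<And>z. z \<noteq> 0 \<Longrightarrow> \<theta> z \<noteq> 0 \<Longrightarrow>
    appell (- 1) 5 0 1 (Q ^ 6 * z) = - 1 * Q powi (3 - 5) * z * appell (- 1) 5 0 (1 - 0) z + C3"
    using appell_shift[of "- 1" 5 0 1] by auto
  have Qm2: "Q powi (- 2) * Q ^ 4 = Q ^ 2"
    using Q_nz by (simp add: power_int_minus field_simps flip: power_add)
  have "f x = 0"
  proof (rule q_difference_Liouville[where A = A and f = f and x = x and k = "- (Q ^ 2)"
        and C = "Q ^ 2 * C2 - C1 - theta_quot * Q ^ 2 * C3", folded R_def])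
    show "f analytic_on R"
    proof (subst analytic_on_analytic_at, intro ballI)
      fix x assume "x \<in> R"
      then show "f analytic_on {x}"
        unfolding R f_def using Q_nz by (auto intro!: analytic_intros prefactor_analytic Lambda_analytic)
    qed
    show "f (Q ^ 6 * x) = - (Q ^ 2) * x * f x + (Q ^ 2 * C2 - C1 - theta_quot * Q ^ 2 * C3)" if "x \<in> R" for x
    proof -
      have x: "x \<noteq> 0" "\<theta> (- x) \<noteq> 0" "\<theta> (- (x * Q ^ 4)) \<noteq> 0" "\<theta> (x * Q ^ 4) \<noteq> 0" "\<theta> (x * Q ^ 2) \<noteq> 0"
        using that by (auto simp: R)
      have "appell 1 1 6 0 (- (Q ^ 6 * x)) = - (Q ^ 2 * x) * (appell 1 1 6 0 (- x) - 6 * appell 1 1 0 1 (- x)) + C1"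
        using x C1[of "- x"] appell_weight[of 1 "- x" 1 6 0 "- 6"] by simp
      moreover have "appell 1 5 6 4 (- (Q ^ 6 * x * Q ^ 4))
          = - (Q ^ 2 * x) * (appell 1 5 6 4 (- (x * Q ^ 4)) - 6 * appell 1 5 0 1 (- (x * Q ^ 4))) + C2"
      proof -
        have "appell 1 5 6 4 (Q ^ 6 * (- (x * Q ^ 4)))
            = Q powi (- 2) * (- (x * Q ^ 4)) * appell 1 5 6 (4 + - 6) (- (x * Q ^ 4)) + C2"
          using x C2[of "- (x * Q ^ 4)"] Q_nz by simp
        also have "Q powi (- 2) * (- (x * Q ^ 4)) = - (Q ^ 2 * x)"
          using Qm2 by (simp add: mult_ac)
        also have "appell 1 5 6 (4 + - 6) (- (x * Q ^ 4))
            = appell 1 5 6 4 (- (x * Q ^ 4)) - 6 * appell 1 5 0 1 (- (x * Q ^ 4))"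
          using x Q_nz by (subst appell_weight) auto
        finally show ?thesis by (simp add: mult_ac)
      qed
      moreover have "appell (- 1) 5 0 1 (Q ^ 6 * x * Q ^ 4)
          = - (Q ^ 2 * x) * appell (- 1) 5 0 1 (x * Q ^ 4) + C3"
      proof -
        have "appell (- 1) 5 0 1 (Q ^ 6 * (x * Q ^ 4))
            = - (Q powi (- 2) * (x * Q ^ 4)) * appell (- 1) 5 0 1 (x * Q ^ 4) + C3"
          using x C3[of "x * Q ^ 4"] Q_nz by simp
        also have "Q powi (- 2) * (x * Q ^ 4) = Q ^ 2 * x"
          using Qm2 by (simp add: mult_ac)
        finally show ?thesis by (simp add: mult_ac)
      qed
      \<comment> \<open>Rewriting the prefactor by A puts the surplus 6 into exactly the form in
        which it arises from the two weighted sums, so it drops out of the difference.\<close>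
      moreover have "prefactor (Q ^ 6 * x) * Lambda (Q ^ 6 * x)
          = - (Q ^ 2 * x) * (prefactor x * Lambda x
              - 6 * (appell 1 1 0 1 (- x) - Q ^ 2 * appell 1 5 0 1 (- (x * Q ^ 4))))"
        unfolding prefactor_shift[OF x(1)] Lambda_shift[OF x(1,5,4)] appell_identity[OF x(1-3), symmetric]
        by (simp add: algebra_simps)
      ultimately show ?thesis
        unfolding f_def by (simp only:) (simp add: algebra_simps)
    qed
    show "((\<lambda>x. (1 - x / a) * f x) \<longlongrightarrow> 0) (at a)" if "a \<in> A" for a
    proof -
      \<comment> \<open>Two groupings of the same expression: the factor 1 - x / a goes to the
        prefactor where that has the pole, and in \<open>fa'\<close> to \<open>Lambda\<close> where
        \<open>Lambda\<close> has it.\<close>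
      have fa: "(1 - x / a) * f x = ((1 - x / a) * prefactor x) * Lambda x - (1 - x / a) * appell 1 1 6 0 (- x)
          + Q ^ 2 * ((1 - x / a) * appell 1 5 6 4 (- (x * Q ^ 4)))
          - theta_quot * Q ^ 2 * ((1 - x / a) * appell (- 1) 5 0 1 (x * Q ^ 4))" for x
        by (simp add: f_def algebra_simps)
      have fa': "(1 - x / a) * f x = prefactor x * ((1 - x / a) * Lambda x) - (1 - x / a) * appell 1 1 6 0 (- x)
          + Q ^ 2 * ((1 - x / a) * appell 1 5 6 4 (- (x * Q ^ 4)))
          - theta_quot * Q ^ 2 * ((1 - x / a) * appell (- 1) 5 0 1 (x * Q ^ 4))" for x
        by (simp add: f_def algebra_simps)
      have La: "(1 - x / a) * Lambda x = (1 - x / a) * (- 2 * zeta_sum (- (Q ^ 2)))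
          - 2 * ((1 - x / a) * zeta_sum (x * Q ^ 2)) - 4 * ((1 - x / a) * zeta_sum (x * Q ^ 4))" for x
        by (simp add: Lambda_def algebra_simps)
      have a0: "a \<noteq> 0"
        using that Q_nz by (auto simp: A_def)
      note reg = tendsto_zero_of_analytic[OF _ a0]
      have Qs: "- 1 / Q ^ 4 * Q ^ 2 = - 1 / Q ^ 2" "- 1 / Q ^ 4 * Q ^ 4 = - 1" "- (- 1 / Q ^ 4) = 1 / Q ^ 4"
        "1 / Q ^ 4 * Q ^ 2 = 1 / Q ^ 2" "1 / Q ^ 4 * Q ^ 4 = 1"
        "1 / Q ^ 2 * Q ^ 2 = 1" "Q ^ 4 / Q ^ 2 = Q ^ 2" "Q ^ 2 / Q ^ 4 = 1 / Q ^ 2" "1 / Q ^ 2 * Q ^ 4 = Q ^ 2"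
        using Q_nz by (simp_all add: field_simps flip: power_add)
      have A1: "((\<lambda>x. (1 - x / a) * appell 1 1 6 0 (- x)) \<longlongrightarrow> 0) (at a)"
      proof (cases "a = - 1")
        case True
        then show ?thesis
          using tendsto_rescale[OF appell_pole[of 1 1 6 0] a0] by simp
      next
        case False
        then have "\<theta> (- a) \<noteq> 0"
          using that \<theta>_nz Q_nz by (auto simp: A_def \<theta>_inverse)
        then show ?thesis
          using a0 by (intro reg) (auto intro!: analytic_intros)
      qed
      have A2: "((\<lambda>x. (1 - x / a) * appell 1 5 6 4 (- (x * Q ^ 4))) \<longlongrightarrow> (if a = - 1 / Q ^ 4 then 4 else 0)) (at a)"
      proof (cases "a = - 1 / Q ^ 4")
        case True
        then show ?thesis
          using tendsto_rescale[OF appell_pole[of 1 5 6 4] a0] by simp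
      next
        case False
        then have "\<theta> (- (a * Q ^ 4)) \<noteq> 0"
          using that \<theta>_nz Q_nz theta_minus_1_nz by (auto simp: A_def Qs)
        then show ?thesis
          using a0 Q_nz False by (auto intro!: reg analytic_intros)
      qed
      have A3: "((\<lambda>x. (1 - x / a) * appell (- 1) 5 0 1 (x * Q ^ 4)) \<longlongrightarrow> (if a = 1 / Q ^ 4 then 1 else 0)) (at a)"
      proof (cases "a = 1 / Q ^ 4")
        case True
        then show ?thesis
          using tendsto_rescale[OF appell_pole[of "- 1" 5 0 1] a0] by simp
      next
        case False
        then have "\<theta> (a * Q ^ 4) \<noteq> 0"
          using that \<theta>_nz Q_nz theta_minus_1_nz by (auto simp: A_def Qs)
        then show ?thesis
          using a0 Q_nz False by (auto intro!: reg analytic_intros)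
      qed
      \<comment> \<open>Needed to evaluate the case distinctions in \<open>A2\<close> and
        \<open>A3\<close>. After multiplication by Q^4, the last four become statements that Q^2 and
        Q^4 differ from 1 and -1.\<close>
      have neq: "1 / Q ^ 4 \<noteq> - 1 / Q ^ 4" "1 / Q ^ 2 \<noteq> 1 / Q ^ 4" "1 / Q ^ 2 \<noteq> - 1 / Q ^ 4"
        "- 1 \<noteq> 1 / Q ^ 4" "- 1 \<noteq> - 1 / Q ^ 4"
      proof -
        have "Q ^ k \<noteq> 1" "Q ^ k \<noteq> - 1" if "k \<in> {1..5}" for k
          using \<theta>_nz[OF that] theta_1 by auto
        from this[of 2] this[of 4]
        have ne: "Q ^ 2 \<noteq> 1" "Q ^ 2 \<noteq> - 1" "Q ^ 4 \<noteq> 1" "Q ^ 4 \<noteq> - 1"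
          by auto
        show "1 / Q ^ 4 \<noteq> - 1 / Q ^ 4"
          using Q_nz by simp
        have *: "u \<noteq> v" if "u * Q ^ 4 \<noteq> v * Q ^ 4" for u v
          using that by blast
        show "1 / Q ^ 2 \<noteq> 1 / Q ^ 4" "1 / Q ^ 2 \<noteq> - 1 / Q ^ 4" "- 1 \<noteq> 1 / Q ^ 4" "- 1 \<noteq> - 1 / Q ^ 4"
          by (rule *; use ne in \<open>simp only: Qs\<close>; simp add: minus_equation_iff)+
      qed
      consider "a = - 1" | "a = - 1 / Q ^ 4" | "a = 1 / Q ^ 4" | "a = 1 / Q ^ 2"
        using \<open>a \<in> A\<close> unfolding A_def by blast
      then show ?thesis
      proof cases
        case 1
        have "Lambda analytic_on {- 1}"
          using Q_nz \<theta>_nz by (intro Lambda_analytic) auto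
        then have "(Lambda \<longlongrightarrow> 0) (at a)"
          unfolding 1 by (rule tendsto_at_analytic) (simp add: Lambda_def zeta_sum_Q4)
        then have "((\<lambda>x. (1 - x / a) * f x) \<longlongrightarrow> 1 * 0 - 0 + Q ^ 2 * 0 - theta_quot * Q ^ 2 * 0) (at a)"
          unfolding fa using A1 A2 A3 prefactor_pole_minus_1 neq unfolding 1
          by (intro tendsto_intros) auto
        then show ?thesis by simp
      next
        case 2
        have "Lambda analytic_on {- 1 / Q ^ 4}"
          using Q_nz \<theta>_nz theta_minus_1_nz by (intro Lambda_analytic) (auto simp: Qs \<theta>_inverse)
        \<comment> \<open>One 2 comes from the inversion of - Q^2, the other from the value - 1 / 2
          at -1; the values at - Q^2 cancel.\<close>
        moreover have "Lambda (- 1 / Q ^ 4) = 4"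
        proof -
          have "- (Q ^ 2) \<noteq> 1"
            using \<theta>_nz(2)[of 2] theta_1 by auto
          then have "zeta_sum (- 1 / Q ^ 2) = - zeta_sum (- (Q ^ 2)) - 1"
            using zeta_sum_inverse[of "- (Q ^ 2)"] Q_nz by simp
          then show ?thesis
            unfolding Lambda_def Qs by (simp add: zeta_sum_minus_1)
        qed
        ultimately have "(Lambda \<longlongrightarrow> 4) (at a)"
          unfolding 2 by (rule tendsto_at_analytic)
        then have "((\<lambda>x. (1 - x / a) * f x) \<longlongrightarrow> - (Q ^ 2) * 4 - 0 + Q ^ 2 * 4 - theta_quot * Q ^ 2 * 0) (at a)"
          unfolding fa using A1 A2 A3 prefactor_pole_minus_Q4 neq unfolding 2
          by (intro tendsto_intros) auto
        then show ?thesis by simp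
      next
        case 3
        have "((\<lambda>x. (1 - x / a) * zeta_sum (x * Q ^ 2)) \<longlongrightarrow> 0) (at a)"
          by (rule reg) (use Q_nz \<theta>_nz in \<open>auto intro!: analytic_intros simp: 3 Qs \<theta>_inverse\<close>)
        moreover have "((\<lambda>x. (1 - x / a) * zeta_sum (x / a)) \<longlongrightarrow> 1) (at a)"
          using zeta_sum_pole a0 by (rule tendsto_rescale)
        then have "((\<lambda>x. (1 - x / a) * zeta_sum (x * Q ^ 4)) \<longlongrightarrow> 1) (at a)"
          by (simp add: 3)
        moreover have "((\<lambda>x. (1 - x / a) * (- 2 * zeta_sum (- (Q ^ 2)))) \<longlongrightarrow> 0) (at a)"
          by (intro reg analytic_intros)
        ultimately have "((\<lambda>x. (1 - x / a) * Lambda x) \<longlongrightarrow> 0 - 2 * 0 - 4 * 1) (at a)"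
          unfolding La by (intro tendsto_intros)
        moreover have "prefactor analytic_on {1 / Q ^ 4}"
          using Q_nz \<theta>_nz theta_minus_1_nz by (intro prefactor_analytic) (auto simp: \<theta>_inverse)
        then have "(prefactor \<longlongrightarrow> prefactor (1 / Q ^ 4)) (at a)"
          unfolding 3 by (rule tendsto_at_analytic) simp
        ultimately have "((\<lambda>x. (1 - x / a) * f x) \<longlongrightarrow>
            prefactor (1 / Q ^ 4) * (0 - 2 * 0 - 4 * 1) - 0 + Q ^ 2 * 0 - theta_quot * Q ^ 2 * 1) (at a)"
          unfolding fa' using A1 A2 A3 neq 3 by (intro tendsto_intros) auto
        then show ?thesis
          using theta_quot_residue by (simp add: algebra_simps)
      next
        case 4
        have "((\<lambda>x. (1 - x / a) * zeta_sum (x * Q ^ 4)) \<longlongrightarrow> 0) (at a)"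
          by (rule reg) (use Q_nz \<theta>_nz in \<open>auto intro!: analytic_intros simp: 4 Qs\<close>)
        moreover have "((\<lambda>x. (1 - x / a) * zeta_sum (x / a)) \<longlongrightarrow> 1) (at a)"
          using zeta_sum_pole a0 by (rule tendsto_rescale)
        then have "((\<lambda>x. (1 - x / a) * zeta_sum (x * Q ^ 2)) \<longlongrightarrow> 1) (at a)"
          by (simp add: 4)
        moreover have "((\<lambda>x. (1 - x / a) * (- 2 * zeta_sum (- (Q ^ 2)))) \<longlongrightarrow> 0) (at a)"
          by (intro reg analytic_intros)
        ultimately have "((\<lambda>x. (1 - x / a) * Lambda x) \<longlongrightarrow> 0 - 2 * 1 - 4 * 0) (at a)"
          unfolding La by (intro tendsto_intros)
        moreover have "prefactor analytic_on {1 / Q ^ 2}"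
          using Q_nz \<theta>_nz by (intro prefactor_analytic) (auto simp: \<theta>_inverse Qs)
        \<comment> \<open>The factor theta(x Q^2) becomes theta(1) = 0 and cancels the simple pole
          of \<open>Lambda\<close>.\<close>
        then have "(prefactor \<longlongrightarrow> 0) (at a)"
          unfolding 4 by (rule tendsto_at_analytic) (simp add: prefactor_def Qs Q_nz)
        ultimately have "((\<lambda>x. (1 - x / a) * f x) \<longlongrightarrow>
            0 * (0 - 2 * 1 - 4 * 0) - 0 + Q ^ 2 * 0 - theta_quot * Q ^ 2 * 0) (at a)"
          unfolding fa' using A1 A2 A3 neq 4 by (intro tendsto_intros) auto
        then show ?thesis by simp
      qed
    qed
    show "x \<in> R"
      using assms by (simp add: R)
  qed (use Q_nz in \<open>auto simp: A_def\<close>)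
  then show ?thesis
    by (simp add: f_def algebra_simps)
qed


section \<open>Translation back to the notation of the theorem\<close>

lemma Lambda_suminf:
  assumes "x \<noteq> 0"
  shows "(\<Sum>m. 2 * (Q ^ 2 * (Q ^ 6) ^ m / (1 + Q ^ 2 * (Q ^ 6) ^ m) - Q ^ 4 * (Q ^ 6) ^ m / (1 + Q ^ 4 * (Q ^ 6) ^ m)
        - x * Q ^ 2 * (Q ^ 6) ^ m / (1 - x * Q ^ 2 * (Q ^ 6) ^ m) + Q ^ 4 / x * (Q ^ 6) ^ m / (1 - Q ^ 4 / x * (Q ^ 6) ^ m))
      - 4 * (x * Q ^ 4 * (Q ^ 6) ^ m / (1 - x * Q ^ 4 * (Q ^ 6) ^ m) - Q ^ 2 / x * (Q ^ 6) ^ m / (1 - Q ^ 2 / x * (Q ^ 6) ^ m)))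
    = Lambda x"
proof -
  have z: "zeta_sum (- (Q ^ 2)) = lambert (- (Q ^ 2)) - lambert (- (Q ^ 4))"
    "zeta_sum (x * Q ^ 2) = lambert (x * Q ^ 2) - lambert (Q ^ 4 / x)"
    "zeta_sum (x * Q ^ 4) = lambert (x * Q ^ 4) - lambert (Q ^ 2 / x)"
  proof -
    have "Q ^ 6 / (x * Q ^ 2) = Q ^ 4 / x" "Q ^ 6 / (x * Q ^ 4) = Q ^ 2 / x" "Q ^ 6 / - (Q ^ 2) = - (Q ^ 4)"
      using Q_nz assms by (simp_all add: field_simps flip: power_add)
    then show "zeta_sum (- (Q ^ 2)) = lambert (- (Q ^ 2)) - lambert (- (Q ^ 4))"
      "zeta_sum (x * Q ^ 2) = lambert (x * Q ^ 2) - lambert (Q ^ 4 / x)"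
      "zeta_sum (x * Q ^ 4) = lambert (x * Q ^ 4) - lambert (Q ^ 2 / x)"
      by (simp_all only: zeta_sum_def)
  qed
  have L: "(\<lambda>m. z * (Q ^ 6) ^ m / (1 - z * (Q ^ 6) ^ m)) sums lambert z" for z
    by (intro has_sum_imp_sums lambert_has_sum)
  \<comment> \<open>The terms with a plus sign in the denominator are Lambert terms at a negative
    argument: u / (1 + u) = - (- u) / (1 - (- u)). The six series then pair up into three values of
    \<open>zeta_sum\<close>.\<close>
  have "(\<lambda>m. 2 * (- (- (Q ^ 2) * (Q ^ 6) ^ m / (1 - - (Q ^ 2) * (Q ^ 6) ^ m)) + - (Q ^ 4) * (Q ^ 6) ^ m / (1 - - (Q ^ 4) * (Q ^ 6) ^ m)
        - x * Q ^ 2 * (Q ^ 6) ^ m / (1 - x * Q ^ 2 * (Q ^ 6) ^ m) + Q ^ 4 / x * (Q ^ 6) ^ m / (1 - Q ^ 4 / x * (Q ^ 6) ^ m))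
      - 4 * (x * Q ^ 4 * (Q ^ 6) ^ m / (1 - x * Q ^ 4 * (Q ^ 6) ^ m) - Q ^ 2 / x * (Q ^ 6) ^ m / (1 - Q ^ 2 / x * (Q ^ 6) ^ m)))
    sums (2 * (- lambert (- (Q ^ 2)) + lambert (- (Q ^ 4)) - lambert (x * Q ^ 2) + lambert (Q ^ 4 / x))
      - 4 * (lambert (x * Q ^ 4) - lambert (Q ^ 2 / x)))"
    by (intro sums_diff sums_add sums_mult sums_minus L)
  moreover have "2 * (- lambert (- (Q ^ 2)) + lambert (- (Q ^ 4)) - lambert (x * Q ^ 2) + lambert (Q ^ 4 / x))
      - 4 * (lambert (x * Q ^ 4) - lambert (Q ^ 2 / x)) = Lambda x"
    by (simp add: Lambda_def z)
  ultimately show ?thesis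
    by (intro sums_unique[symmetric]) simp
qed

end

theorem theorem6:
  fixes l j :: int and q :: complex
  assumes l_pos: "l > 0"
    and q_range: "0 < norm q" "norm q < 1"
    and bracket_nz: "qbracket [- (q powi j), - (q powi (2*l)), - (q powi (4*l + j))] (q powi (6*l)) \<noteq> 0"
    and lambert_nz:
      "\<And>m::nat. 1 + q powi (6*l*int m + 2*l) \<noteq> 0"
      "\<And>m::nat. 1 + q powi (6*l*int m + 4*l) \<noteq> 0"
      "\<And>m::nat. 1 - q powi (6*l*int m + 2*l + j) \<noteq> 0"
      "\<And>m::nat. 1 - q powi (6*l*int m + 4*l - j) \<noteq> 0"
      "\<And>m::nat. 1 - q powi (6*l*int m + 4*l + j) \<noteq> 0"
      "\<And>m::nat. 1 - q powi (6*l*int m + 2*l - j) \<noteq> 0"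
    and appell_nz:
      "\<And>n::int. 1 + q powi (6*l*n + j + 4*l) \<noteq> 0"
      "\<And>n::int. 1 + q powi (6*l*n + j) \<noteq> 0"
      "\<And>n::int. 1 - q powi (6*l*n + j + 4*l) \<noteq> 0"
    and poch_nz: "qpoch (- (q powi (2*l))) (q powi (2*l)) \<noteq> 0"
  shows
    "qbracket [q powi (2*l + j), q powi (4*l)] (q powi (6*l)) * (qpoch (q powi (6*l)) (q powi (6*l)))^2
       / qbracket [- (q powi j), - (q powi (2*l)), - (q powi (4*l + j))] (q powi (6*l))
     * (of_int j + (\<Sum>m::nat.
          2 * (q powi (6*l*int m + 2*l) / (1 + q powi (6*l*int m + 2*l))
               - q powi (6*l*int m + 4*l) / (1 + q powi (6*l*int m + 4*l))
               - q powi (6*l*int m + 2*l + j) / (1 - q powi (6*l*int m + 2*l + j))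
               + q powi (6*l*int m + 4*l - j) / (1 - q powi (6*l*int m + 4*l - j)))
          - 4 * (q powi (6*l*int m + 4*l + j) / (1 - q powi (6*l*int m + 4*l + j))
                 - q powi (6*l*int m + 2*l - j) / (1 - q powi (6*l*int m + 2*l - j)))))
     = - (\<Sum>\<^sub>\<infinity>n::int. of_int (6*n + 4 + j) * q powi (3*l*n*(n+1) + 2*l*n + 2*l)
            / (1 + q powi (6*l*n + j + 4*l)))
       + (\<Sum>\<^sub>\<infinity>n::int. of_int (6*n + j) * q powi (3*l*n*(n+1) - 2*l*n)
            / (1 + q powi (6*l*n + j)))
       + 2 * (qpoch (q powi (2*l)) (q powi (2*l)))^2 / (qpoch (- (q powi (2*l))) (q powi (2*l)))^2
         * (\<Sum>\<^sub>\<infinity>n::int. (-1) powi n * q powi (3*l*n*(n+1) + 2*l*n + 2*l)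
              / (1 - q powi (6*l*n + j + 4*l)))"
proof -
  define Q where "Q = q powi l"
  define x where "x = q powi j"
  have q: "q \<noteq> 0" using q_range by auto
  have Q: "Q \<noteq> 0" "norm Q < 1"
  proof -
    show "Q \<noteq> 0" using q by (simp add: Q_def)
    have "norm q powi l < norm q powi 0"
      using q_range l_pos by (intro power_int_strict_decreasing) auto
    then show "norm Q < 1" by (simp add: Q_def norm_power_int)
  qed
  interpret appell_sums Q
    by unfold_locales (use Q in auto)
  have x: "x \<noteq> 0" using q by (simp add: x_def)
  have Ql: "q powi (l * a) = Q powi a" for a
    by (simp add: Q_def power_int_mult)
  have pQ: "(Q ^ 6) powi n = Q powi (6 * n)" for n
    by (simp add: power_int_mult)
  have pQm: "(Q ^ 6) ^ m = Q powi (6 * int m)" for m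
    using pQ[of "int m"] by simp
  have Q24: "Q ^ 2 = Q powi 2" "Q ^ 4 = Q powi 4" "Q ^ 6 = Q powi 6"
    by simp_all
  have split: "q powi (l * a + j) = Q powi a * x" "q powi (l * a - j) = Q powi a / x" for a
    using q by (simp_all add: power_int_add power_int_diff Ql x_def)
  have e0: "q powi (6 * l) = Q ^ 6" "q powi (2 * l) = Q ^ 2" "q powi (4 * l) = Q ^ 4"
    "q powi (2 * l + j) = x * Q ^ 2" "q powi (4 * l + j) = x * Q ^ 4"
    using Ql[of 6] Ql[of 2] Ql[of 4] split(1)[of 2] split(1)[of 4] by (simp_all add: mult_ac)
  have em: "q powi (6 * l * int m + 2 * l) = Q ^ 2 * (Q ^ 6) ^ m"
    "q powi (6 * l * int m + 4 * l) = Q ^ 4 * (Q ^ 6) ^ m"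
    "q powi (6 * l * int m + 2 * l + j) = x * Q ^ 2 * (Q ^ 6) ^ m"
    "q powi (6 * l * int m + 4 * l - j) = Q ^ 4 / x * (Q ^ 6) ^ m"
    "q powi (6 * l * int m + 4 * l + j) = x * Q ^ 4 * (Q ^ 6) ^ m"
    "q powi (6 * l * int m + 2 * l - j) = Q ^ 2 / x * (Q ^ 6) ^ m" for m
  proof -
    have "6 * l * int m + 2 * l = l * (6 * int m + 2)" "6 * l * int m + 4 * l = l * (6 * int m + 4)"
      by (simp_all add: algebra_simps)
    moreover have "Q powi (6 * int m + 2) = Q ^ 2 * (Q ^ 6) ^ m" "Q powi (6 * int m + 4) = Q ^ 4 * (Q ^ 6) ^ m"
      using Q by (simp_all add: power_int_add pQm)
    ultimately show "q powi (6 * l * int m + 2 * l) = Q ^ 2 * (Q ^ 6) ^ m"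
      "q powi (6 * l * int m + 4 * l) = Q ^ 4 * (Q ^ 6) ^ m"
      "q powi (6 * l * int m + 2 * l + j) = x * Q ^ 2 * (Q ^ 6) ^ m"
      "q powi (6 * l * int m + 4 * l - j) = Q ^ 4 / x * (Q ^ 6) ^ m"
      "q powi (6 * l * int m + 4 * l + j) = x * Q ^ 4 * (Q ^ 6) ^ m"
      "q powi (6 * l * int m + 2 * l - j) = Q ^ 2 / x * (Q ^ 6) ^ m"
      by (simp_all only: split Ql) (simp_all add: mult_ac)
  qed
  have en: "q powi (6 * l * n + j + 4 * l) = x * Q ^ 4 * (Q ^ 6) powi n"
    "q powi (6 * l * n + j) = x * (Q ^ 6) powi n"
    "q powi (3 * l * n * (n + 1) + 2 * l * n + 2 * l) = Q ^ 2 * Q powi (3 * n * n + 5 * n)"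
    "q powi (3 * l * n * (n + 1) - 2 * l * n) = Q powi (3 * n * n + 1 * n)" for n
  proof -
    have "6 * l * n + j + 4 * l = l * (6 * n + 4) + j" "6 * l * n + j = l * (6 * n) + j"
      "3 * l * n * (n + 1) + 2 * l * n + 2 * l = l * (2 + (3 * n * n + 5 * n))"
      "3 * l * n * (n + 1) - 2 * l * n = l * (3 * n * n + 1 * n)"
      by (simp_all add: algebra_simps)
    moreover have "Q powi (6 * n + 4) = Q ^ 4 * (Q ^ 6) powi n"
      "Q powi (2 + (3 * n * n + 5 * n)) = Q ^ 2 * Q powi (3 * n * n + 5 * n)"
      using Q by (simp_all add: power_int_add pQ)
    ultimately show "q powi (6 * l * n + j + 4 * l) = x * Q ^ 4 * (Q ^ 6) powi n"
      "q powi (6 * l * n + j) = x * (Q ^ 6) powi n"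
      "q powi (3 * l * n * (n + 1) + 2 * l * n + 2 * l) = Q ^ 2 * Q powi (3 * n * n + 5 * n)"
      "q powi (3 * l * n * (n + 1) - 2 * l * n) = Q powi (3 * n * n + 1 * n)"
      by (simp_all only: split Ql pQ) (simp_all add: mult_ac)
  qed
  \<comment> \<open>The denominators of a bilateral series run through 1 - z p^n for all integers n,
    so their being nonzero says exactly that z is no power of p.\<close>
  have nz: "\<theta> z \<noteq> 0" if z: "z \<noteq> 0" "\<And>n::int. 1 - z * (Q ^ 6) powi n \<noteq> 0" for z
  proof
    assume "\<theta> z = 0"
    then obtain n :: int where "z = (Q ^ 6) powi n"
      using theta_eq_0_iff[OF z(1)] by blast
    then have "1 - z * (Q ^ 6) powi (- n) = 0"
      using Q by (simp add: power_int_minus)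
    then show False using z(2) by blast
  qed
  have \<theta>x: "\<theta> (- x) \<noteq> 0" "\<theta> (- (x * Q ^ 4)) \<noteq> 0" "\<theta> (x * Q ^ 4) \<noteq> 0"
    using appell_nz[unfolded en] x Q nz[of "- x"] nz[of "- (x * Q ^ 4)"] nz[of "x * Q ^ 4"] by auto
  \<comment> \<open>No bilateral series has this argument. The hypotheses on two one-sided Lambert
    series, with arguments x Q^2 and Q^4 / x, cover the two \<open>qpoch\<close> factors
    instead.\<close>
  have "\<theta> (x * Q ^ 2) \<noteq> 0"
  proof -
    have "Q ^ 6 / (x * Q ^ 2) = Q ^ 4 / x"
      using Q x by (simp add: field_simps flip: power_add)
    then show ?thesis
      using lambert_nz(3,4) unfolding em by (auto simp: theta_def qpoch_eq_0_iff norm_p)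
  qed
  note identities = appell_identity[OF x \<theta>x(1,2)] weighted_appell_identity[OF x \<theta>x this]
  have S1: "(\<Sum>\<^sub>\<infinity>n. of_int (6 * n + 4 + j) * (Q ^ 2 * Q powi (3 * n * n + 5 * n)) / (1 + x * Q ^ 4 * (Q ^ 6) powi n))
      = Q ^ 2 * (appell 1 5 6 4 (- (x * Q ^ 4)) + of_int j * appell 1 5 0 1 (- (x * Q ^ 4)))"
  proof -
    have "of_int (6 * n + 4 + j) * (Q ^ 2 * Q powi (3 * n * n + 5 * n)) / (1 + x * Q ^ 4 * (Q ^ 6) powi n)
        = Q ^ 2 * (coeff 1 5 6 (4 + j) n / (1 - - (x * Q ^ 4) * (Q ^ 6) powi n))" for n
      by (simp add: coeff_def mult_ac add_ac)
    then show ?thesis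
      using x Q \<theta>x by (simp only: infsum_cmult_right' flip: appell_def) (subst appell_weight; simp)
  qed
  have S2: "(\<Sum>\<^sub>\<infinity>n. of_int (6 * n + j) * Q powi (3 * n * n + 1 * n) / (1 + x * (Q ^ 6) powi n))
      = appell 1 1 6 0 (- x) + of_int j * appell 1 1 0 1 (- x)"
  proof -
    have "of_int (6 * n + j) * Q powi (3 * n * n + 1 * n) / (1 + x * (Q ^ 6) powi n)
        = coeff 1 1 6 (0 + j) n / (1 - - x * (Q ^ 6) powi n)" for n
      by (simp add: coeff_def)
    then show ?thesis
      using x \<theta>x by (simp only: flip: appell_def) (subst appell_weight; simp)
  qed
  have S3: "(\<Sum>\<^sub>\<infinity>n. (- 1) powi n * (Q ^ 2 * Q powi (3 * n * n + 5 * n)) / (1 - x * Q ^ 4 * (Q ^ 6) powi n))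
      = Q ^ 2 * appell (- 1) 5 0 1 (x * Q ^ 4)"
  proof -
    have "(- 1) powi n * (Q ^ 2 * Q powi (3 * n * n + 5 * n)) / (1 - x * Q ^ 4 * (Q ^ 6) powi n)
        = Q ^ 2 * (coeff (- 1) 5 0 1 n / (1 - x * Q ^ 4 * (Q ^ 6) powi n))" for n
      by (simp add: coeff_def mult_ac)
    then show ?thesis
      by (simp only: infsum_cmult_right' flip: appell_def)
  qed
  have pref: "qbracket [x * Q ^ 2, Q ^ 4] (Q ^ 6) * (qpoch (Q ^ 6) (Q ^ 6))\<^sup>2
      / qbracket [- x, - (Q ^ 2), - (x * Q ^ 4)] (Q ^ 6) = prefactor x"
    by (simp add: qbracket_def qpochs_def prefactor_def theta_def mult_ac)
  show ?thesis
    \<comment> \<open>B is inserted before A: rewriting by A first would destroy the product of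
      \<open>prefactor x\<close> and \<open>Lambda x\<close> that B refers to.\<close>
    unfolding em en e0 S1 S2 S3 Lambda_suminf[OF x] pref x_def[symmetric]
      distrib_left[of "prefactor x"] mult.commute[of "prefactor x" "of_int j"] identities(2)
    unfolding identities(1) theta_quot_def by (simp add: algebra_simps)
qed

end
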